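(* Consider the recursive MIS algorithm described in the context, run on a graph of maximum degree $\Delta$. For each node $v$, during $T=c\log\Delta$ iterations, for a sufficiently large constant $c$, with probability at least $1-1/\Delta^{98}$ either $v$ or a neighbor of $v$ is added to the independent set; this guarantee holds independent of the randomness outside the $2$-hop neighborhood of $v$. Furthermore, letting $B$ be the set of nodes remaining after $T$ iterations, each connected component of the subgraph induced by $B$ has $O(\log_\Delta n\cdot\Delta^4)$ nodes.
   Context: Recursive MIS algorithm on an $n$-node graph of maximum degree $\Delta$, with $C$ a large constant and $k=12C\log\Delta$. Every node starts with $p_0(v)=1/2$. In each iteration $t$, each remaining node $u$ is independently sampled in each of $k$ repetitions with probability $p_{t-1}(u)$; $\hat d_{t-1}(v)$ is the median over the $k$ repetitions of the number of remaining neighbors of $v$ sampled in that repetition. The $T=c\log\Delta$ iterations form a top-level phase; recursively, every phase of length $R>4\log\log\Delta$ is split into two consecutive subphases of length $R/2$, until phases of length $R$ with $2\log\log\Delta<R\le 4\log\log\Delta$ are reached. A node $u$ not already stalling is stalling in a (sub)phase of length $R$ whose first iteration is $t$ if $\hat d_{t-1}(u)>2^{2R}$; it then stalls in all iterations of that (sub)phase. In iteration $t$: if $v$ is stalling or $\hat d_{t-1}(v)\ge 2$ then $p_t(v)=p_{t-1}(v)/2$, otherwise $p_t(v)=\min\{2p_{t-1}(v),1/2\}$; if $v$ is not stalling, it marks itself with probability $p_t(v)$, and if $v$ is marked and no neighbor is marked, $v$ joins the independent set and $v$ and its neighbors are removed from the graph.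
   Formalization: The component bound cannot hold surely (with positive probability no node ever marks itself), so it is stated with probability at least 1-n^{-a} for every a>0, the O-constant depending only on a; Δ≥3 is assumed, since for Δ≤2 the range 2loglogΔ<R≤4loglogΔ is empty or undefined. *)

theory Defs
  imports "HOL-Probability.Probability" "Graph_Theory.Digraph_Component"
begin

text \<open>Undirected graphs are symmetric digraphs (locale \<^locale>\<open>graph\<close>), so the out-degree is the
  degree. All logarithms without an explicit base are to base 2.\<close>

definition max_degree :: "('a, 'b) pre_digraph \<Rightarrow> nat" where
  "max_degree G = Max (out_degree G ` verts G)"

definition nbrs :: "('a, 'b) pre_digraph \<Rightarrow> 'a \<Rightarrow> 'a set" where
  "nbrs G v = {u. v \<rightarrow>\<^bsub>G\<^esub> u}"

definition two_hop :: "('a, 'b) pre_digraph \<Rightarrow> 'a \<Rightarrow> 'a set" where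
  "two_hop G v = {v} \<union> nbrs G v \<union> (\<Union>u\<in>nbrs G v. nbrs G u)"

definition num_iters :: "real \<Rightarrow> nat \<Rightarrow> nat" where
  "num_iters c \<Delta> = nat \<lceil>c * log 2 (real \<Delta>)\<rceil>"

definition num_reps :: "real \<Rightarrow> nat \<Rightarrow> nat" where
  "num_reps C \<Delta> = nat \<lceil>12 * C * log 2 (real \<Delta>)\<rceil>"

text \<open>\<open>phase \<Delta> T t R\<close>: the recursion creates a (sub)phase consisting of the \<open>R\<close> iterations
  \<open>t, \<dots>, t + R - 1\<close>. A phase of odd length is split into halves whose lengths differ by one.
  The recursion is meaningful only for \<open>\<Delta> \<ge> 3\<close>: for \<open>\<Delta> \<le> 2\<close> the bound \<open>4 log log \<Delta>\<close> is not
  positive and no phase length satisfies the stopping condition.\<close>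

inductive phase :: "nat \<Rightarrow> nat \<Rightarrow> nat \<Rightarrow> nat \<Rightarrow> bool" for \<Delta> T :: nat where
  top: "phase \<Delta> T 1 T"
| fst_half: "phase \<Delta> T t R \<Longrightarrow> real R > 4 * log 2 (log 2 (real \<Delta>)) \<Longrightarrow> phase \<Delta> T t (R div 2)"
| snd_half: "phase \<Delta> T t R \<Longrightarrow> real R > 4 * log 2 (log 2 (real \<Delta>)) \<Longrightarrow>
    phase \<Delta> T (t + R div 2) (R - R div 2)"

text \<open>For lists of even length, the mean of the two middle elements.\<close>

definition median :: "nat list \<Rightarrow> real" where
  "median xs = (real (sort xs ! ((length xs - 1) div 2)) + real (sort xs ! (length xs div 2))) / 2"

text \<open>The coins of a node: \<open>Sample t i\<close> decides whether it is sampled in repetition \<open>i\<close> of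
  iteration \<open>t\<close>, \<open>Mark t\<close> whether it marks itself in iteration \<open>t\<close>. Every coin is an independent
  uniform number in \<open>[0,1]\<close>; an action taken with probability \<open>p\<close> occurs iff its coin is below \<open>p\<close>.\<close>

datatype coin = Sample nat nat | Mark nat

definition coins :: "nat \<Rightarrow> nat \<Rightarrow> coin set" where
  "coins T k = {Sample t i | t i. t \<in> {1..T} \<and> i < k} \<union> {Mark t | t. t \<in> {1..T}}"

definition node_coins :: "'a set \<Rightarrow> real \<Rightarrow> real \<Rightarrow> nat \<Rightarrow> ('a \<times> coin) set" where
  "node_coins S C c \<Delta> = S \<times> coins (num_iters c \<Delta>) (num_reps C \<Delta>)"

definition randomness :: "'a set \<Rightarrow> real \<Rightarrow> real \<Rightarrow> nat \<Rightarrow> ('a \<times> coin \<Rightarrow> real) measure" where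
  "randomness S C c \<Delta> = PiM (node_coins S C c \<Delta>) (\<lambda>_. uniform_measure lborel {0..1})"

text \<open>\<open>stall_end s u\<close> is the last iteration of the latest (sub)phase in which \<open>u\<close> was declared
  stalling (0 if there is none), so \<open>u\<close> is stalling in iteration \<open>t\<close> iff \<open>t \<le> stall_end s u\<close>.\<close>

record 'a state =
  remaining :: "'a set"
  indep_set :: "'a set"
  prb :: "'a \<Rightarrow> real"
  stall_end :: "'a \<Rightarrow> nat"

definition estimate ::
  "('a, 'b) pre_digraph \<Rightarrow> nat \<Rightarrow> ('a \<times> coin \<Rightarrow> real) \<Rightarrow> nat \<Rightarrow> 'a state \<Rightarrow> 'a \<Rightarrow> real" where
  "estimate G k \<omega> t s v =
     median (map (\<lambda>i. card {u \<in> nbrs G v \<inter> remaining s. \<omega> (u, Sample t i) < prb s u}) [0..<k])"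

text \<open>Several nested (sub)phases may start at the same iteration \<open>t\<close>. As they are nested, a node
  that qualifies in some of them stalls until the end of the longest one in which it qualifies,
  which the maximum below selects.\<close>

definition new_stall_end :: "nat \<Rightarrow> nat \<Rightarrow> nat \<Rightarrow> ('a \<Rightarrow> real) \<Rightarrow> 'a state \<Rightarrow> 'a \<Rightarrow> nat" where
  "new_stall_end \<Delta> T t d s u =
     (if t \<le> stall_end s u then stall_end s u
      else Max (insert (stall_end s u) {t + R - 1 | R. phase \<Delta> T t R \<and> d u > 2 ^ (2 * R)}))"

definition iteration ::
  "('a, 'b) pre_digraph \<Rightarrow> nat \<Rightarrow> nat \<Rightarrow> nat \<Rightarrow> ('a \<times> coin \<Rightarrow> real) \<Rightarrow> nat \<Rightarrow> 'a state \<Rightarrow> 'a state" where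
  "iteration G \<Delta> T k \<omega> t s =
     (let d = estimate G k \<omega> t s;
          e = new_stall_end \<Delta> T t d s;
          p = (\<lambda>v. if t \<le> e v \<or> d v \<ge> 2 then prb s v / 2 else min (2 * prb s v) (1 / 2));
          marked = {v \<in> remaining s. \<not> t \<le> e v \<and> \<omega> (v, Mark t) < p v};
          joining = {v \<in> marked. nbrs G v \<inter> marked = {}}
      in \<lparr> remaining = remaining s - (joining \<union> (\<Union>v\<in>joining. nbrs G v)),
           indep_set = indep_set s \<union> joining,
           prb = p,
           stall_end = e \<rparr>)"

primrec state_after ::
  "('a, 'b) pre_digraph \<Rightarrow> nat \<Rightarrow> nat \<Rightarrow> nat \<Rightarrow> ('a \<times> coin \<Rightarrow> real) \<Rightarrow> nat \<Rightarrow> 'a state" where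
  "state_after G \<Delta> T k \<omega> 0 =
     \<lparr> remaining = verts G, indep_set = {}, prb = (\<lambda>_. 1 / 2), stall_end = (\<lambda>_. 0) \<rparr>"
| "state_after G \<Delta> T k \<omega> (Suc t) = iteration G \<Delta> T k \<omega> (Suc t) (state_after G \<Delta> T k \<omega> t)"

definition final_state ::
  "('a, 'b) pre_digraph \<Rightarrow> real \<Rightarrow> real \<Rightarrow> ('a \<times> coin \<Rightarrow> real) \<Rightarrow> 'a state" where
  "final_state G C c \<omega> =
     (let \<Delta> = max_degree G; T = num_iters c \<Delta>
      in state_after G \<Delta> T (num_reps C \<Delta>) \<omega> T)"

definition covered ::
  "('a, 'b) pre_digraph \<Rightarrow> real \<Rightarrow> real \<Rightarrow> 'a \<Rightarrow> ('a \<times> coin \<Rightarrow> real) \<Rightarrow> bool" where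
  "covered G C c v \<omega> \<longleftrightarrow> (\<exists>u \<in> insert v (nbrs G v). u \<in> indep_set (final_state G C c \<omega>))"

text \<open>\<open>H\<close> is a maximal connected subgraph of \<open>G\<close>.\<close>

definition graph_component :: "('a, 'b) pre_digraph \<Rightarrow> ('a, 'b) pre_digraph \<Rightarrow> bool" where
  "graph_component G H \<longleftrightarrow> pre_digraph.max_subgraph G Digraph_Component.connected H"

end

theory Submission
  imports Defs
begin

text \<open>Write \<open>d(v)\<close> for the sum of the marking probabilities of the remaining neighbours of \<open>v\<close>. The
  potential of a node combines \<open>log d(v)\<close>, \<open>log (1 / p(v))\<close> and the number of iterations that \<open>v\<close> still
  has to stall, the latter as far as it exceeds \<open>log d(v)\<close>. When \<open>v\<close> starts to stall for \<open>R\<close> iterations,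
  the test \<open>2 ^ (2 * R)\<close> makes \<open>log d(v)\<close> large enough to pay for all of them, even if \<open>d(v)\<close> collapses
  afterwards. If the estimates are accurate, then in every iteration either the potential decreases by
  1, or the iteration is golden: the potential increases by at most 7, but with constant probability
  a closed neighbour of \<open>v\<close> joins the independent set. Hence the expectation of \<open>\<beta> powr potential\<close>,
  restricted to the event that \<open>v\<close> remains, contracts by a constant factor per iteration for a suitable
  \<open>\<beta> > 1\<close>. An inaccurate estimate has polynomially small probability and costs only \<open>O(log \<Delta>)\<close>.

  Up to one-sided bounds, one iteration at \<open>v\<close> uses only fresh coins in the two-hop neighbourhood
  of \<open>v\<close>, whatever the history. So the contraction factors of nodes at pairwise distance at least 5
  multiply, and a union bound over the 5-separated sets that are connected at distance 5 bounds the
  components. All probabilities are powers of 1/2, so that the coins may be rounded to a finite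
  dyadic grid, which reduces the measure theory to finite sums.\<close>

section \<open>Resampling finitely many coins\<close>

text \<open>Over many iterations the states of distant nodes interact, so their survival events are
  not independent; what is local is one iteration under a fixed history. Hence the induction over
  time carries the expectation of a product of exponential potentials, one factor per node, and not
  a count of golden iterations. The claim on a single node is the product with one factor. Coins
  outside a set \<open>N\<close> of nodes are never drawn: they keep the values of a base point, and
  the bounds hold for every base point. So \<open>N = verts G\<close> and
  \<open>N = two_hop G v\<close> are two instances of one statement, and the second is the
  independence from outer randomness. The exponent 98 has to beat the union bound: a separated set
  of \<open>s\<close> nodes has survival probability at most \<open>\<Delta> ^ (-98 * s)\<close>,
  while there are at most \<open>n * \<Delta> ^ (20 * s)\<close> candidates.\<close>

definition resample :: "'b pmf \<Rightarrow> ('a \<Rightarrow> 'b) \<Rightarrow> 'a set \<Rightarrow> ('a \<Rightarrow> 'b) pmf" where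
  "resample q \<omega> A = map_pmf (\<lambda>y. override_on \<omega> y A) (Pi_pmf A undefined (\<lambda>_. q))"

definition determined_by :: "(('a \<Rightarrow> 'b) \<Rightarrow> 'c) \<Rightarrow> 'a set \<Rightarrow> bool" where
  "determined_by f A \<longleftrightarrow> (\<forall>\<omega> \<omega>'. (\<forall>a\<in>A. \<omega> a = \<omega>' a) \<longrightarrow> f \<omega> = f \<omega>')"

lemma determined_byD: "determined_by f A \<Longrightarrow> (\<And>a. a \<in> A \<Longrightarrow> \<omega> a = \<omega>' a) \<Longrightarrow> f \<omega> = f \<omega>'"
  by (auto simp: determined_by_def)

lemma determined_by_comp: "determined_by f A \<Longrightarrow> determined_by (\<lambda>\<omega>. F (f \<omega>)) A"
  unfolding determined_by_def by metis

lemma determined_by_prod: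
  assumes "\<And>i. i \<in> I \<Longrightarrow> determined_by (f i) (A i)"
  shows "determined_by (\<lambda>\<omega>. \<Prod>i\<in>I. f i \<omega>) (\<Union>i\<in>I. A i)"
  unfolding determined_by_def by (auto intro!: prod.cong determined_byD[OF assms])

lemma finite_set_resample:
  assumes "finite A" "finite (set_pmf q)"
  shows "finite (set_pmf (resample q \<omega> A))"
  using assms by (auto simp: resample_def set_Pi_pmf)

lemma set_resample_outside:
  assumes "finite A" "\<omega>' \<in> set_pmf (resample q \<omega> A)" "a \<notin> A"
  shows "\<omega>' a = \<omega> a"
  using assms by (auto simp: resample_def)

lemma resample_cong:
  assumes "\<And>a. a \<notin> A \<Longrightarrow> \<omega> a = \<omega>' a"
  shows "resample q \<omega> A = resample q \<omega>' A"
proof -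
  have "override_on \<omega> y A = override_on \<omega>' y A" for y
    using assms by (auto simp: override_on_def)
  then show ?thesis by (simp add: resample_def)
qed

lemma resample_Un:
  assumes "finite A" "finite B" "A \<inter> B = {}"
  shows "resample q \<omega> (A \<union> B) = bind_pmf (resample q \<omega> A) (\<lambda>\<omega>'. resample q \<omega>' B)"
proof -
  have "override_on \<omega> (\<lambda>x. if x \<in> A then f x else g x) (A \<union> B) = override_on (override_on \<omega> f A) g B"
    for f g :: "'a \<Rightarrow> 'b"
    using assms(3) by (auto simp: override_on_def fun_eq_iff)
  then show ?thesis
    by (simp add: resample_def Pi_pmf_union[OF assms] map_pmf_def pair_pmf_def bind_assoc_pmf
        bind_return_pmf)
qed

text \<open>Redrawing \<open>A\<close> once more changes nothing in law. This stands in for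
  conditional expectation: the inner draw averages over \<open>A\<close> while every other coin, in
  particular the history, is held fixed.\<close>

lemma resample_resample:
  assumes "finite J" "A \<subseteq> J"
  shows "resample q \<omega> J = bind_pmf (resample q \<omega> J) (\<lambda>\<omega>'. resample q \<omega>' A)"
proof -
  have fin: "finite A" "finite (J - A)" using assms finite_subset by auto
  have J: "resample q \<omega> J = bind_pmf (resample q \<omega> (J - A)) (\<lambda>\<omega>'. resample q \<omega>' A)"
    using resample_Un[of "J - A" A q \<omega>] fin assms(2) by (simp add: Un_absorb2 Diff_Int_distrib2)
  have "bind_pmf (resample q \<omega>' A) (\<lambda>\<omega>''. resample q \<omega>'' A) = resample q \<omega>' A" for \<omega>'
  proof -
    have "bind_pmf (resample q \<omega>' A) (\<lambda>\<omega>''. resample q \<omega>'' A)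
        = bind_pmf (resample q \<omega>' A) (\<lambda>_. resample q \<omega>' A)"
      using set_resample_outside[OF fin(1)] by (intro bind_pmf_cong refl resample_cong) auto
    then show ?thesis by simp
  qed
  then show ?thesis by (subst (2) J, subst J) (simp add: bind_assoc_pmf)
qed

context
  fixes q :: "'b pmf"
  assumes finite_q [simp]: "finite (set_pmf q)"
begin

abbreviation expect :: "('a \<Rightarrow> 'b) \<Rightarrow> 'a set \<Rightarrow> (('a \<Rightarrow> 'b) \<Rightarrow> real) \<Rightarrow> real" where
  "expect \<omega> A f \<equiv> measure_pmf.expectation (resample q \<omega> A) f"

lemma integrable_resample [simp]:
  "finite A \<Longrightarrow> integrable (measure_pmf (resample q \<omega> A)) (f :: _ \<Rightarrow> real)"
  by (intro integrable_measure_pmf_finite finite_set_resample finite_q)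

lemma expect_mono:
  assumes "finite A" "\<And>\<omega>'. \<omega>' \<in> set_pmf (resample q \<omega> A) \<Longrightarrow> f \<omega>' \<le> g \<omega>'"
  shows "expect \<omega> A f \<le> expect \<omega> A g"
  by (intro integral_mono_AE integrable_resample assms AE_pmfI)

lemma expect_cong:
  assumes "finite A" "\<And>\<omega>'. \<omega>' \<in> set_pmf (resample q \<omega> A) \<Longrightarrow> f \<omega>' = g \<omega>'"
  shows "expect \<omega> A f = expect \<omega> A g"
  by (intro integral_cong_AE AE_pmfI assms) simp_all

lemma expect_le_const:
  assumes "finite A" "\<And>\<omega>'. \<omega>' \<in> set_pmf (resample q \<omega> A) \<Longrightarrow> f \<omega>' \<le> c"
  shows "expect \<omega> A f \<le> c"
  using expect_mono[OF assms(1), of \<omega> f "\<lambda>_. c"] assms(2) by simp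

lemma expect_nonneg:
  assumes "finite A" "\<And>\<omega>'. \<omega>' \<in> set_pmf (resample q \<omega> A) \<Longrightarrow> 0 \<le> f \<omega>'"
  shows "0 \<le> expect \<omega> A f"
  using expect_mono[OF assms(1), of \<omega> "\<lambda>_. 0" f] assms(2) by simp

section \<open>Tower rule, independence and a tail bound for majorities\<close>

lemma expect_bind:
  assumes "finite A" "finite B" "resample q \<omega> J = bind_pmf (resample q \<omega> A) (\<lambda>\<omega>'. resample q \<omega>' B)"
  shows "expect \<omega> J f = expect \<omega> A (\<lambda>\<omega>'. expect \<omega>' B f)"
proof -
  have fin: "finite (set_pmf (resample q \<omega>' C))" if "finite C" for \<omega>' and C :: "'a set"
    using that by (intro finite_set_resample finite_q)
  have "expect \<omega> J f = (\<Sum>\<omega>'\<in>set_pmf (resample q \<omega> A). pmf (resample q \<omega> A) \<omega>' *\<^sub>R expect \<omega>' B f)"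
    unfolding assms(3) by (intro pmf_expectation_bind fin assms(1,2) order_refl)
  also have "\<dots> = expect \<omega> A (\<lambda>\<omega>'. expect \<omega>' B f)"
    by (rule integral_measure_pmf[symmetric, OF fin[OF assms(1)]])
  finally show ?thesis .
qed

lemma expect_Un:
  assumes "finite A" "finite B" "A \<inter> B = {}"
  shows "expect \<omega> (A \<union> B) f = expect \<omega> A (\<lambda>\<omega>'. expect \<omega>' B f)"
  using assms by (intro expect_bind resample_Un)

lemma expect_expect:
  assumes "finite J" "A \<subseteq> J"
  shows "expect \<omega> J f = expect \<omega> J (\<lambda>\<omega>'. expect \<omega>' A f)"
  using assms finite_subset by (intro expect_bind resample_resample) auto

text \<open>All coins that \<open>f\<close> reads are redrawn, so the base point is forgotten. The
  change from \<open>\<omega>\<close> to \<open>\<omega>'\<close> allows a bound for one round to be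
  applied under any history.\<close>

lemma expect_determined_cong:
  assumes "finite J" "A \<subseteq> J" "determined_by f A"
  shows "expect \<omega> J f = expect \<omega>' A f"
proof -
  have fin: "finite A" using assms finite_subset by auto
  have *: "expect \<omega>'' A f = expect \<omega>' A f" for \<omega>''
  proof -
    have "f (override_on \<omega>'' y A) = f (override_on \<omega>' y A)" for y
      by (rule determined_byD[OF assms(3)]) simp
    then show ?thesis by (simp add: resample_def)
  qed
  have "expect \<omega> J f = expect \<omega> J (\<lambda>\<omega>''. expect \<omega>'' A f)"
    by (rule expect_expect[OF assms(1,2)])
  also have "\<dots> = expect \<omega> J (\<lambda>_. expect \<omega>' A f)"
    by (intro expect_cong assms(1) *)
  finally show ?thesis by simp
qed

text \<open>With the coins outside \<open>A\<close> fixed, \<open>g\<close> is constant for the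
  inner average over \<open>A\<close>, and the inner average of \<open>f\<close> is the same number
  whatever was fixed.\<close>

lemma expect_mult:
  assumes "finite J" "A \<subseteq> J" "determined_by f A" "determined_by g B" "A \<inter> B = {}"
  shows "expect \<omega> J (\<lambda>\<omega>. f \<omega> * g \<omega>) = expect \<omega> J f * expect \<omega> J g"
proof -
  have fin: "finite A" using assms finite_subset by auto
  have "expect \<omega> J (\<lambda>\<omega>. f \<omega> * g \<omega>) = expect \<omega> J (\<lambda>\<omega>'. expect \<omega>' A (\<lambda>\<omega>. f \<omega> * g \<omega>))"
    by (rule expect_expect[OF assms(1,2)])
  also have "\<dots> = expect \<omega> J (\<lambda>\<omega>'. expect \<omega> J f * g \<omega>')"
  proof (intro expect_cong assms(1))
    fix \<omega>'
    have "expect \<omega>' A (\<lambda>\<omega>. f \<omega> * g \<omega>) = expect \<omega>' A (\<lambda>\<omega>. f \<omega> * g \<omega>')"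
      using assms(5)
      by (intro expect_cong fin arg_cong2[where f = times] refl determined_byD[OF assms(4)]
          set_resample_outside[OF fin]) auto
    then show "expect \<omega>' A (\<lambda>\<omega>. f \<omega> * g \<omega>) = expect \<omega> J f * g \<omega>'"
      by (simp add: expect_determined_cong[OF assms(1-3), of \<omega> \<omega>'])
  qed
  finally show ?thesis by simp
qed

lemma expect_prod:
  assumes "finite J" "finite I" "\<And>i. i \<in> I \<Longrightarrow> A i \<subseteq> J" "disjoint_family_on A I"
    and det: "\<And>i. i \<in> I \<Longrightarrow> determined_by (f i) (A i)"
  shows "expect \<omega> J (\<lambda>\<omega>. \<Prod>i\<in>I. f i \<omega>) = (\<Prod>i\<in>I. expect \<omega> J (f i))"
  using assms(2-)
proof (induction I rule: finite_induct)
  case (insert i I)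
  have "expect \<omega> J (\<lambda>\<omega>. f i \<omega> * (\<Prod>i\<in>I. f i \<omega>)) = expect \<omega> J (f i) * expect \<omega> J (\<lambda>\<omega>. \<Prod>i\<in>I. f i \<omega>)"
  proof (rule expect_mult[OF assms(1)])
    show "determined_by (\<lambda>\<omega>. \<Prod>i\<in>I. f i \<omega>) (\<Union>i\<in>I. A i)"
      using insert.prems by (intro determined_by_prod) auto
    show "A i \<inter> (\<Union>i\<in>I. A i) = {}"
      using insert.prems(2) insert.hyps(2) by (auto simp: disjoint_family_on_def)
  qed (use insert.prems in auto)
  moreover have "expect \<omega> J (\<lambda>\<omega>. \<Prod>i\<in>I. f i \<omega>) = (\<Prod>i\<in>I. expect \<omega> J (f i))"
    using insert.prems by (intro insert.IH) (auto simp: disjoint_family_on_def)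
  ultimately show ?case using insert.hyps by simp
qed simp

lemma expect_coin:
  assumes "finite J" "c \<in> J"
  shows "expect \<omega> J (\<lambda>\<omega>. F (\<omega> c)) = measure_pmf.expectation q F"
proof -
  have "expect \<omega> J (\<lambda>\<omega>. F (\<omega> c)) = measure_pmf.expectation (map_pmf (\<lambda>y. y c) (Pi_pmf J undefined (\<lambda>_. q))) F"
    using assms by (simp add: resample_def)
  also have "\<dots> = measure_pmf.expectation q F"
    using assms by (simp add: Pi_pmf_component)
  finally show ?thesis .
qed

lemma prob_expect:
  "finite A \<Longrightarrow> measure_pmf.prob (resample q \<omega> A) {\<omega>'. P \<omega>'} = expect \<omega> A (\<lambda>\<omega>'. of_bool (P \<omega>'))"
proof -
  have "(\<lambda>\<omega>'. of_bool (P \<omega>')) = (indicator {\<omega>'. P \<omega>'} :: _ \<Rightarrow> real)"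
    by (auto simp: fun_eq_iff indicator_def)
  then show ?thesis by simp
qed

text \<open>Markov's inequality for 64 to the number of bad indices: each factor has mean at most
  \<open>1 + 63 / 64 \<le> 2\<close>, and if at least half of the indices are bad then the product
  is at least \<open>8 ^ k\<close>, which leaves \<open>(2 / 8) ^ k\<close>.\<close>

lemma expect_majority:
  assumes "finite J" "\<And>i. i < k \<Longrightarrow> A i \<subseteq> J" "disjoint_family_on A {..<k}"
    and "\<And>i. i < k \<Longrightarrow> determined_by (bad i) (A i)"
    and "\<And>i. i < k \<Longrightarrow> expect \<omega> J (\<lambda>\<omega>. of_bool (bad i \<omega>)) \<le> 1 / 64"
  shows "expect \<omega> J (\<lambda>\<omega>. of_bool (k \<le> 2 * card {i. i < k \<and> bad i \<omega>})) \<le> (1 / 4) ^ k"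
proof -
  define f :: "nat \<Rightarrow> ('a \<Rightarrow> 'b) \<Rightarrow> real" where "f i \<omega> = 1 + 63 * of_bool (bad i \<omega>)" for i \<omega>
  have f_det: "determined_by (f i) (A i)" if "i < k" for i
    unfolding f_def using assms(4)[OF that] by (rule determined_by_comp)
  have prod_f: "(\<Prod>i<k. f i \<omega>) = 64 ^ card {i. i < k \<and> bad i \<omega>}" for \<omega>
  proof -
    have "(\<Prod>i<k. f i \<omega>) = (\<Prod>i\<in>{i \<in> {..<k}. bad i \<omega>}. 64)"
      by (subst prod.inter_filter) (auto simp: f_def intro!: prod.cong)
    then show ?thesis by simp
  qed
  have "of_bool (k \<le> 2 * card {i. i < k \<and> bad i \<omega>}) \<le> (1 / 8) ^ k * (\<Prod>i<k. f i \<omega>)" for \<omega>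
  proof (cases "k \<le> 2 * card {i. i < k \<and> bad i \<omega>}")
    case True
    then have "(8::real) ^ k \<le> 8 ^ (2 * card {i. i < k \<and> bad i \<omega>})" by (intro power_increasing) auto
    also have "\<dots> = (\<Prod>i<k. f i \<omega>)" by (simp add: prod_f power_mult)
    finally show ?thesis using True by (simp add: field_simps)
  qed (simp add: prod_f)
  then have "expect \<omega> J (\<lambda>\<omega>. of_bool (k \<le> 2 * card {i. i < k \<and> bad i \<omega>}))
      \<le> expect \<omega> J (\<lambda>\<omega>. (1 / 8) ^ k * (\<Prod>i<k. f i \<omega>))"
    by (intro expect_mono assms(1))
  also have "\<dots> = (1 / 8) ^ k * (\<Prod>i<k. expect \<omega> J (f i))"
    using assms(2) f_det by (subst expect_prod[OF assms(1) _ _ assms(3), symmetric]) auto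
  also have "\<dots> \<le> (1 / 8) ^ k * (\<Prod>i<k. 2)"
  proof (intro mult_left_mono prod_mono conjI)
    fix i assume "i \<in> {..<k}"
    show "0 \<le> expect \<omega> J (f i)" by (intro expect_nonneg assms(1)) (simp add: f_def)
    have "expect \<omega> J (f i) = 1 + 63 * expect \<omega> J (\<lambda>\<omega>. of_bool (bad i \<omega>))"
      unfolding f_def by (subst Bochner_Integration.integral_add) (simp_all add: assms(1))
    then show "expect \<omega> J (f i) \<le> 2" using assms(5)[of i] \<open>i \<in> {..<k}\<close> by simp
  qed simp
  also have "\<dots> = (1 / 4) ^ k" by (simp add: power_mult_distrib[symmetric])
  finally show ?thesis .
qed

end

section \<open>The median\<close>

lemma sorted_count_ge:
  assumes "sorted ys" "i < length ys" "P (ys ! i)" "\<And>x y. P x \<Longrightarrow> x \<le> y \<Longrightarrow> P y"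
  shows "length ys - i \<le> length (filter P ys)"
proof -
  have "{i..<length ys} \<subseteq> {j. j < length ys \<and> P (ys ! j)}"
    using assms(4)[OF assms(3) sorted_nth_mono[OF assms(1)]] by auto
  from card_mono[OF _ this] show ?thesis by (simp add: length_filter_conv_card)
qed

lemma sorted_count_le:
  assumes "sorted ys" "i < length ys" "P (ys ! i)" "\<And>x y. P y \<Longrightarrow> x \<le> y \<Longrightarrow> P x"
  shows "i + 1 \<le> length (filter P ys)"
proof -
  have "{..i} \<subseteq> {j. j < length ys \<and> P (ys ! j)}"
    using assms by (auto intro: sorted_nth_mono)
  from card_mono[OF _ this] show ?thesis by (simp add: length_filter_conv_card)
qed

text \<open>For even length the two middle positions differ, and for an upper bound the right one
  decides: if it exceeded \<open>B\<close>, so would all later entries, which are at least half of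
  the list. \<open>median_ge\<close> argues with the left one.\<close>

lemma median_le:
  assumes "2 * length (filter (\<lambda>x. real x > B) xs) < length xs"
  shows "median xs \<le> B"
proof -
  define ys where "ys = sort xs"
  let ?n = "length xs"
  have ys: "sorted ys" "length ys = ?n" "length (filter P ys) = length (filter P xs)" for P
    by (simp_all add: ys_def filter_sort)
  have "real (ys ! (?n div 2)) \<le> B"
  proof (rule ccontr)
    assume "\<not> ?thesis"
    then have "?n - ?n div 2 \<le> length (filter (\<lambda>x. real x > B) xs)"
      using sorted_count_ge[of ys "?n div 2" "\<lambda>x. real x > B"] ys assms by auto
    with assms show False by linarith
  qed
  moreover have "ys ! ((?n - 1) div 2) \<le> ys ! (?n div 2)"
    using ys assms by (intro sorted_nth_mono) (auto intro: div_le_mono)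
  then have "real (ys ! ((?n - 1) div 2)) \<le> real (ys ! (?n div 2))" by (rule of_nat_mono)
  ultimately show ?thesis by (simp add: median_def ys_def)
qed

lemma median_ge:
  assumes "2 * length (filter (\<lambda>x. real x < B) xs) < length xs"
  shows "median xs \<ge> B"
proof -
  define ys where "ys = sort xs"
  let ?n = "length xs"
  have ys: "sorted ys" "length ys = ?n" "length (filter P ys) = length (filter P xs)" for P
    by (simp_all add: ys_def filter_sort)
  have lt: "(?n - 1) div 2 < ?n" "?n div 2 < ?n" using assms by auto
  have "real (ys ! ((?n - 1) div 2)) \<ge> B"
  proof (rule ccontr)
    assume "\<not> ?thesis"
    then have "(?n - 1) div 2 + 1 \<le> length (filter (\<lambda>x. real x < B) xs)"
      using sorted_count_le[of ys "(?n - 1) div 2" "\<lambda>x. real x < B"] ys lt by auto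
    with assms show False by linarith
  qed
  moreover have "ys ! ((?n - 1) div 2) \<le> ys ! (?n div 2)"
    using ys assms by (intro sorted_nth_mono) (auto intro: div_le_mono)
  then have "real (ys ! ((?n - 1) div 2)) \<le> real (ys ! (?n div 2))" by (rule of_nat_mono)
  ultimately show ?thesis by (simp add: median_def ys_def)
qed

section \<open>The potential of a node\<close>

text \<open>A logarithm clipped at 0. The 64 is the factor by which an accurate estimate may exceed
  the degree, so that passing the stalling test with length \<open>R\<close> gives
  \<open>2 * R < phi d\<close>.\<close>

definition phi :: "real \<Rightarrow> real" where
  "phi d = log 2 (max (64 * d) 1)"

text \<open>Origin of the weights: a stalling iteration at low degree adds 1 by halving
  \<open>p\<close>, so one unit of outstanding stall must be worth 2 for a net loss of 1. The part
  of the stall up to \<open>phi d - 1\<close> is not charged, so a drop of \<open>phi\<close> by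
  \<open>x\<close> can uncover stall worth \<open>2 * x\<close>. Weight 6 on \<open>phi\<close>
  leaves \<open>4 * x\<close>, and with \<open>x = 1 / 2\<close> this pays for the halving of
  \<open>p\<close> and for the decrease by 1.\<close>

definition psi :: "real \<Rightarrow> real \<Rightarrow> real \<Rightarrow> real" where
  "psi d p r = 6 * phi d + log 2 (1 / (2 * p)) + 2 * max (r - max (phi d - 1) 0) 0"

lemma phi_nonneg: "0 \<le> phi d"
  by (simp add: phi_def)

lemma phi_mono: "d \<le> d' \<Longrightarrow> phi d \<le> phi d'"
  by (simp add: phi_def)

lemma phi_double: "d' \<le> 2 * d \<Longrightarrow> phi d' \<le> phi d + 1"
proof -
  assume "d' \<le> 2 * d"
  then have "log 2 (max (64 * d') 1) \<le> log 2 (2 * max (64 * d) 1)"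
    by (subst log_le_cancel_iff) auto
  also have "\<dots> = 1 + phi d" by (subst log_mult) (auto simp: phi_def)
  finally show ?thesis by (simp add: phi_def)
qed

text \<open>\<open>13 / 20\<close> is just below \<open>1 / sqrt 2\<close>, and
  \<open>d \<ge> 1 / 32\<close> keeps \<open>64 * d / sqrt 2\<close> above 1, so the clipping does
  not spoil the drop.\<close>

lemma phi_shrink:
  assumes "d \<ge> 1 / 32" "d' \<le> 13 / 20 * d"
  shows "phi d' \<le> phi d - 1 / 2"
proof -
  have half: "(2::real) powr (-1/2) = 1 / sqrt 2"
    by (simp add: powr_minus_divide powr_half_sqrt)
  have "sqrt 2 * (13 / 20) \<le> (1::real)"
    by (rule power2_le_imp_le) (auto simp: power_mult_distrib power2_eq_square)
  then have "13 / 20 \<le> 1 / sqrt (2::real)" by (simp add: field_simps)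
  then have "max (64 * d') 1 \<le> (1 / sqrt 2) * (64 * d)"
    using assms mult_right_mono[of "13 / 20" "1 / sqrt 2" "64 * d"] sqrt2_less_2 by (simp add: max_def)
  then have "log 2 (max (64 * d') 1) \<le> log 2 ((1 / sqrt 2) * (64 * d))"
    using assms by (subst log_le_cancel_iff) auto
  also have "\<dots> = log 2 (2 powr (-1/2)) + log 2 (64 * d)"
    unfolding half using assms by (intro log_mult_pos) auto
  also have "\<dots> = phi d - 1 / 2" using assms by (simp add: phi_def max_def)
  finally show ?thesis by (simp add: phi_def)
qed

lemma phi_small: "d \<le> 1 / 64 \<Longrightarrow> phi d = 0"
  by (simp add: phi_def max_def)

lemma phi_less_1: "d < 1 / 32 \<Longrightarrow> phi d < 1"
  by (simp add: phi_def log_less_iff)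

text \<open>The stall term falls as \<open>d\<close> grows, but at rate at most 2 in
  \<open>phi d\<close>, against the rate 6 of the first term. This is what makes it safe to neglect
  removals of neighbours.\<close>

lemma psi_mono: "d \<le> d' \<Longrightarrow> psi d p r \<le> psi d' p r"
  using phi_mono[of d d'] phi_nonneg[of d] by (simp add: psi_def max_def)

lemma psi_nonneg: "0 < p \<Longrightarrow> p \<le> 1 / 2 \<Longrightarrow> 0 \<le> psi d p r"
  using phi_nonneg[of d] zero_le_log_cancel_iff[of 2 "1 / (2 * p)"] by (simp add: psi_def)

lemma log_halve:
  assumes "0 < p" "p / 2 \<le> p'"
  shows "log 2 (1 / (2 * p')) \<le> log 2 (1 / (2 * p)) + 1"
proof -
  have "log 2 (1 / (2 * p')) \<le> log 2 (2 * (1 / (2 * p)))"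
    using assms by (subst log_le_cancel_iff) (auto simp: field_simps)
  also have "\<dots> = 1 + log 2 (1 / (2 * p))" using assms by (subst log_mult) auto
  finally show ?thesis by simp
qed

context
  fixes d d' p p' r r' :: real
  assumes p: "0 < p" "p / 2 \<le> p'"
begin

lemma psi_round_high_degree:
  assumes "d \<ge> 1 / 32" "d' \<le> 13 / 20 * d" "r' \<le> max r (max (phi d - 1) 0)"
  shows "psi d' p' r' \<le> psi d p r - 1"
  using phi_shrink[OF assms(1,2)] log_halve[OF p] assms(3) phi_nonneg[of d'] by (simp add: psi_def max_def split: if_splits)

lemma psi_round_stalling:
  assumes "d < 1 / 32" "phi d' \<le> phi d" "1 \<le> r" "r' = r - 1"
  shows "psi d' p' r' \<le> psi d p r - 1"
  using phi_less_1[OF assms(1)] log_halve[OF p] assms(2-) phi_nonneg[of d'] by (simp add: psi_def max_def)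

lemma psi_round_doubling:
  assumes "d < 1 / 32" "phi d' \<le> phi d" "r' = 0" "p' = 2 * p"
  shows "psi d' p' r' \<le> psi d p r - 1"
proof -
  have "log 2 (1 / (2 * p')) = log 2 (1 / (2 * p)) - 1"
  proof -
    have "log 2 (1 / (2 * p)) = log 2 (2 * (1 / (2 * p')))" using assms(4) by simp
    also have "\<dots> = 1 + log 2 (1 / (2 * p'))" using p by (subst log_mult) auto
    finally show ?thesis by simp
  qed
  then show ?thesis
    using phi_less_1[OF assms(1)] assms(2-) phi_nonneg[of d'] by (simp add: psi_def max_def)
qed

text \<open>The 7 is 6 for a doubled \<open>d\<close> plus 1 for a halved \<open>p\<close>; stall
  beyond the uncharged part costs \<open>2 * L\<close>. If \<open>phi\<close> falls instead, its
  weight 6 outweighs the stall that it uncovers.\<close>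

lemma psi_round_any:
  assumes "d' \<le> 2 * d" "r' \<le> max r (max (phi d - 1) 0 + L)" "0 \<le> L"
  shows "psi d' p' r' \<le> psi d p r + 7 + 2 * L"
  using phi_double[OF assms(1)] log_halve[OF p] assms(2,3) phi_nonneg[of d'] phi_nonneg[of d]
  by (simp add: psi_def max_def split: if_splits)

end

section \<open>One iteration\<close>

definition nbr_sum :: "('a, 'b) pre_digraph \<Rightarrow> 'a state \<Rightarrow> ('a \<Rightarrow> real) \<Rightarrow> 'a \<Rightarrow> real" where
  "nbr_sum G s f v = (\<Sum>u\<in>nbrs G v \<inter> remaining s. f u)"

text \<open>The estimate lies below some power of two, so only finitely many lengths
  \<open>R\<close> pass the test. Hence the maximum is attained, either by the old value or by one
  such \<open>R\<close>.\<close>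

lemma new_stall_end_cases:
  obtains "new_stall_end \<Delta> T t d s v = stall_end s v"
  | R where "\<not> t \<le> stall_end s v" "new_stall_end \<Delta> T t d s v = t + R - 1" "d v > 2 ^ (2 * R)"
proof -
  let ?A = "{t + R - 1 | R. phase \<Delta> T t R \<and> d v > 2 ^ (2 * R)}"
  obtain N where N: "d v < 2 ^ N" using real_arch_pow[of 2 "d v"] by auto
  have "2 * R < N" if "d v > 2 ^ (2 * R)" for R
  proof -
    have "(2::real) ^ (2 * R) < 2 ^ N" using that N by linarith
    then show ?thesis by (simp only: power_strict_increasing_iff)
  qed
  then have "?A \<subseteq> (\<lambda>R. t + R - 1) ` {..<N}" by force
  then have "finite ?A" using finite_subset by blast
  then have "Max (insert (stall_end s v) ?A) \<in> insert (stall_end s v) ?A"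
    by (intro Max_in) auto
  then have "new_stall_end \<Delta> T t d s v \<in> insert (stall_end s v) ?A" if "\<not> t \<le> stall_end s v"
    using that by (simp add: new_stall_end_def)
  moreover have "new_stall_end \<Delta> T t d s v = stall_end s v" if "t \<le> stall_end s v"
    using that by (simp add: new_stall_end_def)
  ultimately show thesis using that by blast
qed

lemma new_stall_end_old: "t \<le> stall_end s v \<Longrightarrow> new_stall_end \<Delta> T t d s v = stall_end s v"
  by (simp add: new_stall_end_def)

text \<open>Greedy choice: an element is added only while the sum is below 1/2, and it is itself at
  most 1/2, so the sum never exceeds 1.\<close>

lemma subset_sum_between:
  fixes f :: "'a \<Rightarrow> real"
  assumes "finite L" "\<And>x. x \<in> L \<Longrightarrow> 0 \<le> f x \<and> f x \<le> 1 / 2"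
  obtains L' where "L' \<subseteq> L" "sum f L' \<le> 1" "min (sum f L) (1 / 2) \<le> sum f L'"
proof -
  have "\<exists>L'\<subseteq>L. sum f L' \<le> 1 \<and> min (sum f L) (1 / 2) \<le> sum f L'"
    using assms
  proof (induction L rule: finite_induct)
    case (insert x L)
    then obtain L' where L': "L' \<subseteq> L" "sum f L' \<le> 1" "min (sum f L) (1 / 2) \<le> sum f L'" by auto
    show ?case
    proof (cases "sum f L' \<ge> 1 / 2")
      case True
      then show ?thesis using L' by (intro exI[of _ L']) auto
    next
      case False
      have "x \<notin> L'" "finite L'" using L'(1) insert.hyps finite_subset by auto
      then have *: "sum f (insert x L') = f x + sum f L'" by simp
      have x: "0 \<le> f x" "f x \<le> 1 / 2" using insert.prems by auto
      have "sum f (insert x L') \<le> 1" using * x False by linarith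
      moreover have "min (sum f (insert x L)) (1 / 2) \<le> sum f (insert x L')"
        using L'(3) * x False insert.hyps by (simp add: min_def split: if_splits)
      ultimately show ?thesis using L'(1) by (intro exI[of _ "insert x L'"]) auto
    qed
  qed auto
  then show thesis using that by blast
qed

section \<open>Deterministic effect of one iteration on the potential\<close>

locale mis_graph = graph G for G :: "('a, 'b) pre_digraph" +
  fixes \<Delta> T k :: nat
  assumes card_nbrs: "card (nbrs G v) \<le> \<Delta>"
    and Delta_ge: "3 \<le> \<Delta>"
    and k_pos: "0 < k"
begin

lemma nbrs_subset: "nbrs G v \<subseteq> verts G"
  by (auto simp: nbrs_def)

lemma finite_nbrs [simp]: "finite (nbrs G v)"
  using nbrs_subset finite_verts finite_subset by blast

lemma nbrs_sym: "u \<in> nbrs G v \<longleftrightarrow> v \<in> nbrs G u"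
  using sym_arcs by (auto simp: nbrs_def symmetric_def dest: symD)

lemma not_self_nbr: "v \<notin> nbrs G v"
  by (auto simp: nbrs_def dest: adj_not_same)

lemma finite_two_hop: "finite (two_hop G v)"
  by (simp add: two_hop_def)

lemma two_hop_subset: "v \<in> verts G \<Longrightarrow> two_hop G v \<subseteq> verts G"
  using nbrs_subset by (auto simp: two_hop_def)

end

text \<open>\<open>s\<close> is the state before iteration \<open>t\<close>. The exponent range
  reflects that \<open>p\<close> starts at 1/2 and has been halved at most once in each of the
  \<open>t - 1\<close> earlier iterations.\<close>

locale mis_round = mis_graph +
  fixes t :: nat and s :: "'a state"
  assumes t: "1 \<le> t" "t \<le> T"
    and dyadic: "\<exists>j\<in>{1..t}. prb s v = (1 / 2) ^ j"
    and remaining_subset: "remaining s \<subseteq> verts G"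
begin

abbreviation deg where "deg \<equiv> nbr_sum G s (prb s)"

definition est where "est \<omega> = estimate G k \<omega> t s"
definition stall where "stall \<omega> = new_stall_end \<Delta> T t (est \<omega>) s"
definition new_prb where
  "new_prb \<omega> v = (if t \<le> stall \<omega> v \<or> est \<omega> v \<ge> 2 then prb s v / 2 else min (2 * prb s v) (1 / 2))"
definition max_prb where "max_prb v = min (2 * prb s v) (1 / 2)"

lemma prb_bounds: "0 < prb s v" "prb s v \<le> 1 / 2"
proof -
  obtain j where "j \<in> {1..t}" "prb s v = (1 / 2) ^ j" using dyadic by blast
  then show "0 < prb s v" "prb s v \<le> 1 / 2"
    using power_decreasing[of 1 j "1/2::real"] by auto
qed

lemma new_prb_bounds: "prb s v / 2 \<le> new_prb \<omega> v" "new_prb \<omega> v \<le> 2 * prb s v" "new_prb \<omega> v \<le> 1 / 2"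
  using prb_bounds[of v] by (auto simp: new_prb_def)

lemma new_prb_le_max: "new_prb \<omega> v \<le> max_prb v"
  using prb_bounds[of v] by (auto simp: new_prb_def max_prb_def)

lemma deg_nonneg: "0 \<le> deg v"
  unfolding nbr_sum_def using prb_bounds(1) by (intro sum_nonneg) (auto intro: less_imp_le)

lemma new_deg_le: "nbr_sum G s (new_prb \<omega>) v \<le> 2 * deg v"
  unfolding nbr_sum_def sum_distrib_left by (intro sum_mono new_prb_bounds)

text \<open>Only \<open>t - 1\<close> iterations are over, so iteration \<open>t\<close> itself
  still counts as outstanding stall; the truncated subtraction gives 0 for a stall that has
  expired.\<close>

definition pot :: "'a \<Rightarrow> real" where
  "pot v = psi (deg v) (prb s v) (real (stall_end s v - (t - 1)))"

text \<open>Neglecting the removals of iteration \<open>t\<close> only increases the potential, and makes it depend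
  on the coins in the two-hop neighbourhood of the node alone.\<close>

definition new_pot :: "('a \<times> coin \<Rightarrow> real) \<Rightarrow> 'a \<Rightarrow> real" where
  "new_pot \<omega> v = psi (nbr_sum G s (new_prb \<omega>) v) (new_prb \<omega> v) (real (stall \<omega> v - t))"

text \<open>The errors that can hurt \<open>v\<close>: too high an estimate at \<open>v\<close>,
  which could stall it or halve its probability without cause, and too low an estimate at a crowded
  neighbour, whose probability would then fail to halve.\<close>

definition accurate :: "('a \<times> coin \<Rightarrow> real) \<Rightarrow> 'a \<Rightarrow> bool" where
  "accurate \<omega> v \<longleftrightarrow> est \<omega> v \<le> 64 * deg v \<and> (\<forall>w\<in>nbrs G v. deg w \<ge> 14 \<longrightarrow> est \<omega> w \<ge> 2)"

text \<open>The members of \<open>L\<close> face little competition, from neighbours by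
  \<open>deg w \<le> 14\<close> and among themselves by the sum bound 1, yet together they mark with
  constant probability. The constant \<open>1 / 2560\<close> is
  \<open>1 / 128 * 1 / 10 * 1 / 2\<close>: a degree of at least 1/128, a tenth of which lies on
  light neighbours, whose probabilities at worst halve.\<close>

definition golden :: "('a \<times> coin \<Rightarrow> real) \<Rightarrow> 'a \<Rightarrow> 'a set \<Rightarrow> bool" where
  "golden \<omega> v L \<longleftrightarrow> L \<subseteq> insert v (nbrs G v) \<inter> remaining s \<and>
     (\<forall>w\<in>L. \<not> t \<le> stall \<omega> w \<and> deg w \<le> 14) \<and> (\<Sum>w\<in>L. prb s w) \<le> 1 \<and> 1 / 2560 \<le> (\<Sum>w\<in>L. new_prb \<omega> w)"

lemma est_le: "est \<omega> v \<le> \<Delta>"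
proof -
  have "card {u \<in> nbrs G v \<inter> remaining s. \<omega> (u, Sample t i) < prb s u} \<le> \<Delta>" for i
    using card_mono[of "nbrs G v" "{u \<in> nbrs G v \<inter> remaining s. \<omega> (u, Sample t i) < prb s u}"] card_nbrs[of v]
    by auto
  then show ?thesis
    unfolding est_def estimate_def using k_pos by (intro median_le) (auto simp: filter_map o_def not_less)
qed

lemma stall_remaining_accurate:
  assumes "est \<omega> v \<le> 64 * deg v"
  shows "real (stall \<omega> v - t) \<le> max (real (stall_end s v - (t - 1))) (max (phi (deg v) - 1) 0)"
    and "t \<le> stall \<omega> v \<Longrightarrow> deg v < 1 / 32 \<Longrightarrow> t \<le> stall_end s v"
proof -
  \<comment> \<open>The test gives \<open>2 * R < phi (deg v)\<close>, so for
    \<open>1 \<le> R\<close> the new stall fits into the part \<open>phi (deg v) - 1\<close> that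
    \<open>psi\<close> does not charge. Moreover \<open>4 \<le> 2 ^ (2 * R) < 64 * deg v\<close>, so
    a node of degree below 1/32 cannot start to stall.\<close>
  have *: "real R \<le> phi (deg v) - 1" "deg v > 1 / 16" if "est \<omega> v > 2 ^ (2 * R)" "1 \<le> R" for R
  proof -
    have "2 ^ (2 * R) < 64 * deg v" using that(1) assms by linarith
    then have "2 powr (2 * real R) < 64 * deg v" by (simp add: powr_realpow[symmetric])
    moreover have "2 powr 2 \<le> 2 powr (2 * real R)" using that(2) by (intro powr_mono) auto
    ultimately show "deg v > 1 / 16" by (simp add: powr_numeral)
    have "2 * real R = log 2 (2 powr (2 * real R))" by simp
    also have "\<dots> < log 2 (64 * deg v)"
      using \<open>2 powr (2 * real R) < 64 * deg v\<close> \<open>deg v > 1 / 16\<close> by (subst log_less_cancel_iff) auto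
    also have "\<dots> = phi (deg v)" using \<open>deg v > 1 / 16\<close> by (simp add: phi_def max_def)
    finally show "real R \<le> phi (deg v) - 1" using that(2) by linarith
  qed
  show "real (stall \<omega> v - t) \<le> max (real (stall_end s v - (t - 1))) (max (phi (deg v) - 1) 0)"
  proof (rule new_stall_end_cases[of \<Delta> T t "est \<omega>" s v], goal_cases)
    case 1
    then show ?case by (auto simp: stall_def max_def)
  next
    case (2 R)
    then have "stall \<omega> v - t \<le> R - 1" by (auto simp: stall_def)
    then show ?case using *[OF 2(3)] by (cases "1 \<le> R") auto
  qed
  show "t \<le> stall_end s v" if "t \<le> stall \<omega> v" "deg v < 1 / 32"
  proof (rule new_stall_end_cases[of \<Delta> T t "est \<omega>" s v], goal_cases)
    case 1
    then show ?case using that by (auto simp: stall_def)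
  next
    case (2 R)
    then have "1 \<le> R" using that t by (auto simp: stall_def)
    then show ?case using *[OF 2(3)] that by auto
  qed
qed

text \<open>Even a wrong estimate is a median of counts of at most \<open>\<Delta>\<close>
  neighbours, so a passed test forces \<open>R \<le> log 2 \<Delta> / 2\<close>. This limits the
  price of inaccuracy.\<close>

lemma stall_remaining_any:
  "real (stall \<omega> v - t) \<le> max (real (stall_end s v - (t - 1))) (log 2 \<Delta> / 2)"
proof (rule new_stall_end_cases[of \<Delta> T t "est \<omega>" s v], goal_cases)
  case 1
  then show ?case by (auto simp: stall_def max_def)
next
  case (2 R)
  have "2 powr (2 * real R) < real \<Delta>" using 2(3) est_le[of \<omega> v] by (simp add: powr_realpow[symmetric])
  then have "2 * real R \<le> log 2 \<Delta>" using Delta_ge by (simp add: le_log_iff)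
  moreover have "stall \<omega> v - t \<le> R" using 2 by (auto simp: stall_def)
  then have "real (stall \<omega> v - t) \<le> real R" by (rule of_nat_mono)
  ultimately show ?case by simp
qed

lemma new_pot_le: "new_pot \<omega> v \<le> pot v + 7 + log 2 \<Delta>"
  using psi_round_any[OF prb_bounds(1)[of v] new_prb_bounds(1)[of v \<omega>] new_deg_le[of \<omega> v],
      of "real (stall \<omega> v - t)" "real (stall_end s v - (t - 1))" "log 2 \<Delta> / 2"]
    stall_remaining_any[of \<omega> v] Delta_ge
  by (auto simp: pot_def new_pot_def max_def split: if_splits)

lemma new_pot_le_accurate:
  assumes "accurate \<omega> v"
  shows "new_pot \<omega> v \<le> pot v + 7"
  using psi_round_any[OF prb_bounds(1)[of v] new_prb_bounds(1)[of v \<omega>] new_deg_le[of \<omega> v],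
      of "real (stall \<omega> v - t)" "real (stall_end s v - (t - 1))" 0] stall_remaining_accurate(1)[of \<omega> v] assms
  by (auto simp: pot_def new_pot_def max_def accurate_def split: if_splits)

lemma accurate_round:
  assumes acc: "accurate \<omega> v" and v: "v \<in> remaining s"
  shows "new_pot \<omega> v \<le> pot v - 1 \<or> (\<exists>L. golden \<omega> v L)"
proof -
  define N where "N = nbrs G v \<inter> remaining s"
  define L where "L = {w \<in> N. \<not> t \<le> stall \<omega> w \<and> deg w < 14}"
  have fin: "finite N" "L \<subseteq> N" by (auto simp: N_def L_def)
  have fin_L: "finite L" using fin finite_subset by auto
  let ?d = "deg v" and ?d' = "nbr_sum G s (new_prb \<omega>) v"
  note stall = stall_remaining_accurate[of \<omega> v]
  have est: "est \<omega> v \<le> 64 * ?d" using acc by (simp add: accurate_def)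
  note bounds = prb_bounds(1)[of v] new_prb_bounds(1)[of v \<omega>]
  show ?thesis
  proof (cases "?d \<ge> 1 / 128 \<and> (\<Sum>w\<in>L. prb s w) \<ge> ?d / 10")
    case True
    \<comment> \<open>The light neighbours may carry too much probability in total, which would make
      them block each other; a part of them with sum at most 1 is enough. The cap 1/2 in the minimum
      is harmless, being above 1/1280.\<close>
    obtain L' where L': "L' \<subseteq> L" "sum (prb s) L' \<le> 1" "min (sum (prb s) L) (1 / 2) \<le> sum (prb s) L'"
      using subset_sum_between[OF fin_L, of "prb s"] prb_bounds by (metis less_imp_le)
    have "1 / 1280 \<le> sum (prb s) L'" using True L'(3) by (simp add: min_def split: if_splits)
    then have "1 / 2560 \<le> (\<Sum>w\<in>L'. prb s w / 2)" by (simp add: sum_divide_distrib[symmetric])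
    also have "\<dots> \<le> sum (new_prb \<omega>) L'" by (intro sum_mono new_prb_bounds)
    finally have "golden \<omega> v L'"
      using L'(1,2) unfolding golden_def by (force simp: L_def N_def)
    then show ?thesis by blast
  next
    case not_light: False
    have halved: "new_prb \<omega> w = prb s w / 2" if "w \<in> N - L" for w
      using that acc by (auto simp: new_prb_def L_def N_def accurate_def)
    \<comment> \<open>Everything outside \<open>L\<close> halves and \<open>L\<close> at most
      doubles; as \<open>L\<close> carries at most a tenth of the degree, the new degree is at most
      \<open>9 / 20 + 2 / 10 = 13 / 20\<close> of the old one.\<close>
    have shrink: "?d' \<le> 13 / 20 * ?d" if "?d \<ge> 1 / 128"
    proof -
      have "?d' = sum (new_prb \<omega>) (N - L) + sum (new_prb \<omega>) L"
        unfolding nbr_sum_def N_def[symmetric] by (intro sum.subset_diff fin)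
      also have "sum (new_prb \<omega>) (N - L) = sum (prb s) (N - L) / 2"
        by (simp add: halved sum_divide_distrib)
      also have "sum (new_prb \<omega>) L \<le> 2 * sum (prb s) L"
        unfolding sum_distrib_left by (intro sum_mono new_prb_bounds)
      finally have "?d' \<le> sum (prb s) (N - L) / 2 + 2 * sum (prb s) L" by simp
      moreover have "?d = sum (prb s) (N - L) + sum (prb s) L"
        unfolding nbr_sum_def N_def[symmetric] by (intro sum.subset_diff fin)
      moreover have "sum (prb s) L \<le> ?d / 10" using not_light that by linarith
      ultimately show ?thesis by linarith
    qed
    show ?thesis
    proof (cases "?d \<ge> 1 / 32")
      case True
      then have "?d \<ge> 1 / 128" by linarith
      then show ?thesis
        unfolding pot_def new_pot_def
        by (intro disjI1 psi_round_high_degree[OF bounds] shrink True stall(1)[OF est])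
    next
      case False
      \<comment> \<open>From 1/128 on the degree shrinks. Below 1/128 even a doubled degree is at
        most 1/64, where \<open>phi\<close> vanishes.\<close>
      have phi: "phi ?d' \<le> phi ?d"
      proof (cases "?d \<ge> 1 / 128")
        case True
        then show ?thesis using shrink by (intro phi_mono) auto
      next
        case False
        then have "?d' \<le> 1 / 64" using new_deg_le[of \<omega> v] by linarith
        then show ?thesis using phi_small[of ?d'] phi_nonneg[of ?d] by simp
      qed
      show ?thesis
      proof (cases "t \<le> stall \<omega> v")
        case True
        then have "t \<le> stall_end s v" using stall(2)[OF est] False by auto
        moreover from this have "stall \<omega> v = stall_end s v" by (simp add: stall_def new_stall_end_old)
        ultimately have "1 \<le> real (stall_end s v - (t - 1))"
          "real (stall \<omega> v - t) = real (stall_end s v - (t - 1)) - 1" using t by auto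
        then show ?thesis
          using False phi unfolding pot_def new_pot_def
          by (intro disjI1 psi_round_stalling[OF bounds]) auto
      next
        case no_stall: False
        \<comment> \<open>\<open>64 * deg v < 64 / 32 = 2\<close>: the accurate estimate stays
          strictly below the halving threshold.\<close>
        have "est \<omega> v < 2" using est False by linarith
        then have np: "new_prb \<omega> v = min (2 * prb s v) (1 / 2)" using no_stall by (simp add: new_prb_def)
        show ?thesis
        proof (cases "2 * prb s v \<le> 1 / 2")
          case True
          then have "new_prb \<omega> v = 2 * prb s v" using np by simp
          moreover have "real (stall \<omega> v - t) = 0" using no_stall by simp
          ultimately show ?thesis
            using False phi unfolding pot_def new_pot_def
            by (intro disjI1 psi_round_doubling[OF bounds]) auto
        next
          case 2: False
          \<comment> \<open>Doubling hits the cap, so the potential cannot fall; but then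
            \<open>v\<close> itself marks with probability 1/2 while its degree is below
            1/32.\<close>
          have "golden \<omega> v {v}"
            using v no_stall False np 2 prb_bounds[of v] unfolding golden_def by auto
          then show ?thesis by blast
        qed
      qed
    qed
  qed
qed

end

section \<open>The randomness of one iteration\<close>

text \<open>Any finite law that gives the dyadic thresholds their correct probabilities will do. The
  exponent \<open>T + 1\<close> is the largest that the marking probability can reach in the last
  iteration.\<close>

locale mis_coins = mis_graph +
  fixes q :: "real pmf"
  assumes finite_q [simp]: "finite (set_pmf q)"
    and prob_q: "j \<in> {1..T + 1} \<Longrightarrow> measure_pmf.prob q {x. x < (1 / 2) ^ j} = (1 / 2) ^ j"
begin

lemma expect_below:
  assumes "finite J" "c \<in> J" "\<exists>j\<in>{1..T + 1}. p = (1 / 2) ^ j"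
  shows "expect q \<omega> J (\<lambda>\<omega>. of_bool (\<omega> c < p)) = p"
proof -
  have "(\<lambda>x. of_bool (x < p)) = (indicator {x. x < p} :: real \<Rightarrow> real)"
    by (auto simp: fun_eq_iff indicator_def)
  then have "measure_pmf.expectation q (\<lambda>x. of_bool (x < p)) = p" using prob_q assms(3) by auto
  then show ?thesis using expect_coin[OF finite_q assms(1,2), of \<omega> "\<lambda>x. of_bool (x < p)"] by simp
qed

end

locale mis_round_coins = mis_round + mis_coins
begin

lemma prb_dyadic: "\<exists>j\<in>{1..T + 1}. prb s v = (1 / 2) ^ j"
  using dyadic[of v] t by force

lemma half_prb_dyadic: "\<exists>j\<in>{1..t + 1}. prb s v / 2 = (1 / 2) ^ j"
proof -
  obtain j where "j \<in> {1..t}" "prb s v = (1 / 2) ^ j" using dyadic by blast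
  then show ?thesis by (intro bexI[of _ "j + 1"]) auto
qed

lemma max_prb_dyadic: "\<exists>j\<in>{1..t + 1}. max_prb v = (1 / 2) ^ j"
proof -
  obtain j where j: "j \<in> {1..t}" "prb s v = (1 / 2) ^ j" using dyadic by blast
  show ?thesis
  proof (cases "j = 1")
    case True
    then show ?thesis using j by (intro bexI[of _ 1]) (auto simp: max_prb_def)
  next
    case False
    then obtain i where i: "j = Suc i" "1 \<le> i" using j by (cases j) auto
    then have "(1 / 2 :: real) ^ i \<le> (1 / 2) ^ 1" by (intro power_decreasing) auto
    then show ?thesis using i j by (intro bexI[of _ i]) (auto simp: max_prb_def)
  qed
qed

lemma new_prb_dyadic: "\<exists>j\<in>{1..t + 1}. new_prb \<omega> v = (1 / 2) ^ j"
  using half_prb_dyadic[of v] max_prb_dyadic[of v] by (simp add: new_prb_def max_prb_def)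

lemma Suc_t_dyadic: "\<exists>j\<in>{1..t + 1}. p = (1 / 2) ^ j \<Longrightarrow> \<exists>j\<in>{1..T + 1}. p = (1 / 2 :: real) ^ j"
  using t by force

section \<open>Tail bounds for the sampled degree and its median\<close>

definition count :: "'a \<Rightarrow> nat \<Rightarrow> ('a \<times> coin \<Rightarrow> real) \<Rightarrow> nat" where
  "count v i \<omega> = card {u \<in> nbrs G v \<inter> remaining s. \<omega> (u, Sample t i) < prb s u}"

lemma est_count: "est \<omega> v = median (map (\<lambda>i. count v i \<omega>) [0..<k])"
  by (simp add: est_def estimate_def count_def)

lemma count_sum:
  "real (count v i \<omega>) = (\<Sum>u\<in>nbrs G v \<inter> remaining s. of_bool (\<omega> (u, Sample t i) < prb s u))"
  by (simp add: count_def sum_of_bool_eq Collect_conj_eq Int_assoc)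

context
  fixes J :: "('a \<times> coin) set" and v :: 'a
  assumes J: "finite J" "\<And>u i. u \<in> nbrs G v \<Longrightarrow> i < k \<Longrightarrow> (u, Sample t i) \<in> J"
begin

lemma count_upper_tail:
  assumes "i < k"
  shows "expect q \<omega> J (\<lambda>\<omega>. of_bool (real (count v i \<omega>) > 64 * deg v)) \<le> 1 / 64"
proof (cases "deg v = 0")
  case True
  then have "prb s u = 0" if "u \<in> nbrs G v \<inter> remaining s" for u
    using that prb_bounds(1)[THEN less_imp_le]
    by (subst (asm) nbr_sum_def, subst (asm) sum_nonneg_eq_0_iff) auto
  then have "nbrs G v \<inter> remaining s = {}" using prb_bounds(1) by (metis ex_in_conv less_irrefl)
  then show ?thesis using True by (simp add: count_def)
next
  case False
  then have pos: "0 < deg v" using deg_nonneg[of v] by simp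
  have "expect q \<omega> J (\<lambda>\<omega>. of_bool (real (count v i \<omega>) > 64 * deg v))
      \<le> expect q \<omega> J (\<lambda>\<omega>. real (count v i \<omega>) / (64 * deg v))"
    using pos by (intro expect_mono J finite_q) (auto simp: of_bool_def field_simps)
  also have "\<dots> = expect q \<omega> J (\<lambda>\<omega>. real (count v i \<omega>)) / (64 * deg v)" by simp
  also have "expect q \<omega> J (\<lambda>\<omega>. real (count v i \<omega>))
      = (\<Sum>u\<in>nbrs G v \<inter> remaining s. expect q \<omega> J (\<lambda>\<omega>. of_bool (\<omega> (u, Sample t i) < prb s u)))"
    unfolding count_sum by (intro Bochner_Integration.integral_sum integrable_resample J finite_q)
  also have "\<dots> = deg v"
    unfolding nbr_sum_def using assms J by (intro sum.cong expect_below prb_dyadic) auto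
  finally show ?thesis using pos by simp
qed

text \<open>Markov's inequality for \<open>(1 / 2) ^ count\<close>, whose mean is at most
  \<open>exp (- (deg v / 2))\<close>. On the event the count is 0 or 1, which costs a factor 2;
  degree 14 then gives \<open>2 * exp (- 7) \<le> 2 / 128\<close>.\<close>

lemma count_lower_tail:
  assumes "i < k" "deg v \<ge> 14"
  shows "expect q \<omega> J (\<lambda>\<omega>. of_bool (real (count v i \<omega>) < 2)) \<le> 1 / 64"
proof -
  define N where "N = nbrs G v \<inter> remaining s"
  define f :: "'a \<Rightarrow> ('a \<times> coin \<Rightarrow> real) \<Rightarrow> real"
    where "f u \<omega> = 1 - 1 / 2 * of_bool (\<omega> (u, Sample t i) < prb s u)" for u \<omega>
  have prod_f: "(\<Prod>u\<in>N. f u \<omega>) = (1 / 2) ^ count v i \<omega>" for \<omega>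
  proof -
    have "(\<Prod>u\<in>N. f u \<omega>) = (\<Prod>u\<in>{u \<in> N. \<omega> (u, Sample t i) < prb s u}. 1 / 2)"
      by (subst prod.inter_filter) (auto simp: f_def N_def intro!: prod.cong)
    then show ?thesis by (simp add: count_def N_def)
  qed
  have "expect q \<omega> J (\<lambda>\<omega>. of_bool (real (count v i \<omega>) < 2)) \<le> expect q \<omega> J (\<lambda>\<omega>. 2 * (\<Prod>u\<in>N. f u \<omega>))"
  proof (intro expect_mono J finite_q)
    fix \<omega>
    have "1 \<le> 2 * (1 / 2 :: real) ^ count v i \<omega>" if "count v i \<omega> < 2"
      using that by (cases "count v i \<omega>") auto
    then show "of_bool (real (count v i \<omega>) < 2) \<le> 2 * (\<Prod>u\<in>N. f u \<omega>)"
      unfolding prod_f by (auto simp: of_bool_def)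
  qed
  also have "\<dots> = 2 * expect q \<omega> J (\<lambda>\<omega>. \<Prod>u\<in>N. f u \<omega>)" by simp
  also have "expect q \<omega> J (\<lambda>\<omega>. \<Prod>u\<in>N. f u \<omega>) = (\<Prod>u\<in>N. expect q \<omega> J (f u))"
    using J assms
    by (intro expect_prod[where A = "\<lambda>u. {(u, Sample t i)}"])
      (auto simp: N_def disjoint_family_on_def determined_by_def f_def)
  also have "\<dots> \<le> (\<Prod>u\<in>N. exp (- (prb s u / 2)))"
  proof (intro prod_mono conjI)
    fix u assume "u \<in> N"
    show "0 \<le> expect q \<omega> J (f u)" by (intro expect_nonneg J finite_q) (auto simp: f_def)
    have "expect q \<omega> J (f u) = 1 - 1 / 2 * expect q \<omega> J (\<lambda>\<omega>. of_bool (\<omega> (u, Sample t i) < prb s u))"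
      unfolding f_def by (subst Bochner_Integration.integral_diff) (simp_all add: J)
    also have "expect q \<omega> J (\<lambda>\<omega>. of_bool (\<omega> (u, Sample t i) < prb s u)) = prb s u"
      using assms J \<open>u \<in> N\<close> by (intro expect_below prb_dyadic) (auto simp: N_def)
    finally show "expect q \<omega> J (f u) \<le> exp (- (prb s u / 2))"
      using exp_ge_add_one_self[of "- (prb s u / 2)"] by simp
  qed
  also have "\<dots> = exp (- (deg v / 2))"
    by (simp add: exp_sum[symmetric] nbr_sum_def N_def sum_negf sum_divide_distrib)
  also have "\<dots> \<le> exp (- 7)" using assms(2) by simp
  also have "\<dots> \<le> 1 / 128"
  proof -
    have "(2::real) ^ 7 \<le> exp 1 ^ 7" using exp_ge_add_one_self[of 1] by (intro power_mono) auto
    also have "\<dots> = exp 7" by (simp add: exp_of_nat_mult[symmetric])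
    finally show ?thesis by (simp add: exp_minus field_simps)
  qed
  finally show ?thesis by simp
qed

text \<open>Distinct repetitions read disjoint sets of coins, so a bad outcome in half of them has
  probability exponentially small in \<open>k\<close>. The predicate \<open>P\<close> stands for
  either tail.\<close>

lemma est_tail:
  assumes "\<And>i. i < k \<Longrightarrow> expect q \<omega> J (\<lambda>\<omega>. of_bool (P (count v i \<omega>))) \<le> 1 / 64"
  shows "expect q \<omega> J (\<lambda>\<omega>. of_bool (k \<le> 2 * length (filter P (map (\<lambda>i. count v i \<omega>) [0..<k])))) \<le> (1 / 4) ^ k"
proof -
  have "length (filter P (map (\<lambda>i. count v i \<omega>) [0..<k])) = card {i. i < k \<and> P (count v i \<omega>)}" for \<omega>
    by (simp add: length_filter_conv_card cong: conj_cong)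
  moreover have "determined_by (\<lambda>\<omega>. P (count v i \<omega>)) (nbrs G v \<times> {Sample t i})" for i
    unfolding determined_by_def count_def
    by (intro allI impI arg_cong[where f = P] arg_cong[where f = card]) auto
  ultimately show ?thesis
    using assms J
    by (simp only:) (intro expect_majority[where A = "\<lambda>i. nbrs G v \<times> {Sample t i}"],
        auto simp: disjoint_family_on_def)
qed

lemma est_upper_tail: "expect q \<omega> J (\<lambda>\<omega>. of_bool (est \<omega> v > 64 * deg v)) \<le> (1 / 4) ^ k"
proof -
  have "expect q \<omega> J (\<lambda>\<omega>. of_bool (est \<omega> v > 64 * deg v)) \<le> expect q \<omega> J (\<lambda>\<omega>. of_bool
      (k \<le> 2 * length (filter (\<lambda>x. real x > 64 * deg v) (map (\<lambda>i. count v i \<omega>) [0..<k]))))"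
  proof (intro expect_mono J finite_q)
    fix \<omega>
    show "of_bool (est \<omega> v > 64 * deg v) \<le> (of_bool
      (k \<le> 2 * length (filter (\<lambda>x. real x > 64 * deg v) (map (\<lambda>i. count v i \<omega>) [0..<k]))) :: real)"
      using median_le[of "64 * deg v" "map (\<lambda>i. count v i \<omega>) [0..<k]"]
      by (cases "est \<omega> v > 64 * deg v") (auto simp: est_count simp del: filter_map intro: leI)
  qed
  also have "\<dots> \<le> (1 / 4) ^ k" by (intro est_tail count_upper_tail)
  finally show ?thesis .
qed

lemma est_lower_tail:
  assumes "deg v \<ge> 14"
  shows "expect q \<omega> J (\<lambda>\<omega>. of_bool (est \<omega> v < 2)) \<le> (1 / 4) ^ k"
proof -
  have "expect q \<omega> J (\<lambda>\<omega>. of_bool (est \<omega> v < 2)) \<le> expect q \<omega> J (\<lambda>\<omega>. of_bool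
      (k \<le> 2 * length (filter (\<lambda>x. real x < 2) (map (\<lambda>i. count v i \<omega>) [0..<k]))))"
  proof (intro expect_mono J finite_q)
    fix \<omega>
    show "of_bool (est \<omega> v < 2) \<le> (of_bool
      (k \<le> 2 * length (filter (\<lambda>x. real x < 2) (map (\<lambda>i. count v i \<omega>) [0..<k]))) :: real)"
      using median_ge[of 2 "map (\<lambda>i. count v i \<omega>) [0..<k]"]
      by (cases "est \<omega> v < 2") (auto simp: est_count simp del: filter_map intro: leI)
  qed
  also have "\<dots> \<le> (1 / 4) ^ k" by (intro est_tail count_lower_tail assms)
  finally show ?thesis .
qed

end

definition sample_coins where "sample_coins v = two_hop G v \<times> {Sample t i | i. i < k}"
definition mark_coins where "mark_coins v = two_hop G v \<times> {Mark t}"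

lemma finite_coins [simp]: "finite (sample_coins v)" "finite (mark_coins v)"
  by (simp_all add: sample_coins_def mark_coins_def finite_two_hop)

lemma not_accurate_prob:
  "expect q \<omega> (sample_coins v) (\<lambda>\<omega>. of_bool (\<not> accurate \<omega> v)) \<le> (\<Delta> + 1) * (1 / 4) ^ k"
proof -
  let ?E = "expect q \<omega> (sample_coins v)"
  define H where "H = {w \<in> nbrs G v. deg w \<ge> 14}"
  have H: "finite H" "card H \<le> \<Delta>"
    using card_mono[of "nbrs G v" H] card_nbrs[of v] by (auto simp: H_def)
  have "?E (\<lambda>\<omega>. of_bool (\<not> accurate \<omega> v))
      \<le> ?E (\<lambda>\<omega>. of_bool (est \<omega> v > 64 * deg v) + (\<Sum>w\<in>H. of_bool (est \<omega> w < 2)))"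
  proof (intro expect_mono finite_q finite_coins)
    fix \<omega>
    show "of_bool (\<not> accurate \<omega> v) \<le> (of_bool (est \<omega> v > 64 * deg v) + (\<Sum>w\<in>H. of_bool (est \<omega> w < 2)) :: real)"
    proof (cases "accurate \<omega> v \<or> est \<omega> v > 64 * deg v")
      case True
      then show ?thesis by (auto simp: of_bool_def intro!: sum_nonneg add_nonneg_nonneg)
    next
      case False
      then obtain w where "w \<in> H" "est \<omega> w < 2" by (auto simp: accurate_def H_def not_le not_less)
      then have "(1::real) \<le> (\<Sum>w\<in>H. of_bool (est \<omega> w < 2))"
        using member_le_sum[of w H "\<lambda>w. of_bool (est \<omega> w < 2) :: real"] H by auto
      then show ?thesis by (auto simp: of_bool_def)
    qed
  qed
  also have "\<dots> = ?E (\<lambda>\<omega>. of_bool (est \<omega> v > 64 * deg v)) + (\<Sum>w\<in>H. ?E (\<lambda>\<omega>. of_bool (est \<omega> w < 2)))"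
    by (subst Bochner_Integration.integral_add)
      (auto intro!: Bochner_Integration.integral_sum integrable_resample Bochner_Integration.integrable_sum)
  also have "\<dots> \<le> (1 / 4) ^ k + (\<Sum>w\<in>H. (1 / 4) ^ k)"
    by (intro add_mono sum_mono est_upper_tail est_lower_tail finite_coins)
      (auto simp: H_def sample_coins_def two_hop_def)
  also have "\<dots> = (real (card H) + 1) * (1 / 4) ^ k" by (simp add: algebra_simps)
  also have "\<dots> \<le> (\<Delta> + 1) * (1 / 4) ^ k" using H by (intro mult_right_mono) auto
  finally show ?thesis .
qed

end

section \<open>Probability of covering and expected potential in one iteration\<close>

context mis_round_coins
begin

text \<open>Comparing the coins of the competitors with \<open>max_prb\<close> instead of their actual marking
  probability makes this event depend only on the coins in the two-hop neighbourhood of \<open>v\<close>.\<close>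

definition covering :: "('a \<times> coin \<Rightarrow> real) \<Rightarrow> 'a \<Rightarrow> bool" where
  "covering \<omega> v \<longleftrightarrow> (\<exists>w\<in>insert v (nbrs G v) \<inter> remaining s.
     \<not> t \<le> stall \<omega> w \<and> \<omega> (w, Mark t) < new_prb \<omega> w \<and>
     (\<forall>u\<in>nbrs G w \<inter> remaining s. max_prb u \<le> \<omega> (u, Mark t)))"

lemma est_cong:
  assumes "\<And>u i. u \<in> nbrs G w \<Longrightarrow> i < k \<Longrightarrow>
    \<omega> (u, Sample t i) < prb s u \<longleftrightarrow> \<omega>' (u, Sample t i) < prb s u"
  shows "est \<omega> w = est \<omega>' w"
proof -
  have "count w i \<omega> = count w i \<omega>'" if "i < k" for i
    unfolding count_def using assms that by (intro arg_cong[where f = card]) auto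
  then have "map (\<lambda>i. count w i \<omega>) [0..<k] = map (\<lambda>i. count w i \<omega>') [0..<k]" by simp
  then show ?thesis by (simp only: est_count)
qed

lemma stall_cong: "est \<omega> w = est \<omega>' w \<Longrightarrow> stall \<omega> w = stall \<omega>' w"
  by (simp add: stall_def new_stall_end_def)

lemma new_prb_cong: "est \<omega> w = est \<omega>' w \<Longrightarrow> new_prb \<omega> w = new_prb \<omega>' w"
  using stall_cong[of \<omega> w \<omega>'] by (simp add: new_prb_def)

lemma new_pot_cong:
  assumes "\<And>w. w \<in> insert v (nbrs G v) \<Longrightarrow> est \<omega> w = est \<omega>' w"
  shows "new_pot \<omega> v = new_pot \<omega>' v"
proof -
  have "nbr_sum G s (new_prb \<omega>) v = nbr_sum G s (new_prb \<omega>') v"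
    unfolding nbr_sum_def using assms by (intro sum.cong new_prb_cong) auto
  then show ?thesis
    using assms stall_cong[of \<omega> v \<omega>'] new_prb_cong[of \<omega> v \<omega>'] by (simp add: new_pot_def)
qed

lemma covering_cong:
  assumes "\<And>w. w \<in> insert v (nbrs G v) \<Longrightarrow> est \<omega> w = est \<omega>' w"
    and "\<And>u. u \<in> two_hop G v \<Longrightarrow> \<omega> (u, Mark t) = \<omega>' (u, Mark t)"
  shows "covering \<omega> v \<longleftrightarrow> covering \<omega>' v"
proof -
  have "\<not> t \<le> stall \<omega> w \<and> \<omega> (w, Mark t) < new_prb \<omega> w \<and>
      (\<forall>u\<in>nbrs G w \<inter> remaining s. max_prb u \<le> \<omega> (u, Mark t)) \<longleftrightarrow>
    \<not> t \<le> stall \<omega>' w \<and> \<omega>' (w, Mark t) < new_prb \<omega>' w \<and>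
      (\<forall>u\<in>nbrs G w \<inter> remaining s. max_prb u \<le> \<omega>' (u, Mark t))"
    if w: "w \<in> insert v (nbrs G v)" for w
  proof -
    have "\<omega> (u, Mark t) = \<omega>' (u, Mark t)" if "u \<in> insert w (nbrs G w)" for u
      using w that by (intro assms(2)) (auto simp: two_hop_def)
    then show ?thesis
      using stall_cong[OF assms(1)[OF w]] new_prb_cong[OF assms(1)[OF w]] by simp
  qed
  then show ?thesis unfolding covering_def by (intro bex_cong refl) blast
qed

lemma prod_of_bool: "finite A \<Longrightarrow> (\<Prod>x\<in>A. of_bool (P x)) = (of_bool (\<forall>x\<in>A. P x) :: real)"
  by (induction A rule: finite_induct) auto

lemma exp_le_one_minus: "0 \<le> x \<Longrightarrow> x \<le> 1 / 2 \<Longrightarrow> exp (- 2 * x) \<le> 1 - (x::real)"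
proof -
  assume x: "0 \<le> x" "x \<le> 1 / 2"
  have "- 2 * x \<le> - x - 2 * x\<^sup>2"
    using mult_left_mono[OF x(2) x(1)] by (simp add: power2_eq_square)
  also have "\<dots> \<le> ln (1 - x)" by (rule ln_one_minus_pos_lower_bound[OF x])
  finally have "exp (- 2 * x) \<le> exp (ln (1 - x))" by simp
  then show ?thesis using x by simp
qed

text \<open>A node of \<open>L\<close> has competitors of total marking probability at most \<open>2 * 14 + 2 = 30\<close>, all of
  which fail with probability at least \<open>exp (- 60)\<close>.\<close>

lemma not_covering_prob:
  assumes "golden \<omega> v L"
  shows "expect q \<omega> (mark_coins v) (\<lambda>\<omega>. of_bool (\<not> covering \<omega> v)) \<le> 1 - exp (- 60) / 2560"
proof -
  let ?J = "mark_coins v"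
  let ?E = "expect q \<omega> ?J"
  define p where "p = new_prb \<omega>"
  have L: "L \<subseteq> insert v (nbrs G v)" "L \<subseteq> remaining s" "\<And>w. w \<in> L \<Longrightarrow> \<not> t \<le> stall \<omega> w"
    "\<And>w. w \<in> L \<Longrightarrow> deg w \<le> 14" "sum (prb s) L \<le> 1" "1 / 2560 \<le> sum p L"
    using assms by (auto simp: golden_def p_def)
  have fin_L: "finite L" using L(1) finite_subset[OF _ finite.insertI[OF finite_nbrs]] by blast
  \<comment> \<open>The other members of \<open>L\<close> count as competitors even if not adjacent
    to \<open>w\<close>. This makes the events \<open>W w\<close> mutually exclusive, so that their
    probabilities simply add up.\<close>
  define C where "C w = (nbrs G w \<inter> remaining s \<union> L) - {w}" for w
  define W where "W w \<omega> \<longleftrightarrow> \<omega> (w, Mark t) < p w \<and> (\<forall>u\<in>C w. max_prb u \<le> \<omega> (u, Mark t))"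
    for w and \<omega> :: "'a \<times> coin \<Rightarrow> real"
  have C: "finite (C w)" "w \<notin> C w" for w using fin_L by (auto simp: C_def)
  have coins: "(u, Mark t) \<in> ?J" if "w \<in> L" "u \<in> insert w (C w)" for u w
    using that L(1) by (auto simp: C_def mark_coins_def two_hop_def)
  have mb: "0 \<le> max_prb u" "max_prb u \<le> 1 / 2" "max_prb u \<le> 2 * prb s u" for u
    using prb_bounds[of u] by (auto simp: max_prb_def)
  have prob_W: "?E (\<lambda>\<omega>. of_bool (W w \<omega>)) \<ge> p w * exp (- 60)" if w: "w \<in> L" for w
  proof -
    define f where "f u = (\<lambda>\<omega> :: 'a \<times> coin \<Rightarrow> real.
      if u = w then of_bool (\<omega> (u, Mark t) < p u) else 1 - of_bool (\<omega> (u, Mark t) < max_prb u) :: real)" for u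
    have "of_bool (W w \<omega>) = (\<Prod>u\<in>insert w (C w). f u \<omega>)" for \<omega>
    proof -
      have "(\<Prod>u\<in>C w. f u \<omega>) = (\<Prod>u\<in>C w. of_bool (max_prb u \<le> \<omega> (u, Mark t)))"
        using C(2) by (intro prod.cong) (auto simp: f_def)
      also have "\<dots> = of_bool (\<forall>u\<in>C w. max_prb u \<le> \<omega> (u, Mark t))"
        by (rule prod_of_bool[OF C(1)])
      finally show ?thesis using C by (simp add: W_def f_def[of w])
    qed
    then have "?E (\<lambda>\<omega>. of_bool (W w \<omega>)) = ?E (\<lambda>\<omega>. \<Prod>u\<in>insert w (C w). f u \<omega>)" by simp
    also have "\<dots> = (\<Prod>u\<in>insert w (C w). ?E (f u))"
      using C coins[OF w]
      by (intro expect_prod[where A = "\<lambda>u. {(u, Mark t)}"])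
        (auto simp: disjoint_family_on_def determined_by_def f_def)
    also have "\<dots> = ?E (f w) * (\<Prod>u\<in>C w. ?E (f u))" using C by simp
    also have "?E (f w) = p w"
    proof -
      have "\<exists>j\<in>{1..T + 1}. p w = (1 / 2) ^ j"
        unfolding p_def by (intro Suc_t_dyadic new_prb_dyadic)
      then show ?thesis using coins[OF w, of w] by (simp add: f_def expect_below)
    qed
    also have "(\<Prod>u\<in>C w. ?E (f u)) = (\<Prod>u\<in>C w. 1 - max_prb u)"
    proof (intro prod.cong refl)
      fix u assume u: "u \<in> C w"
      then have "f u = (\<lambda>\<omega>. 1 - of_bool (\<omega> (u, Mark t) < max_prb u))"
        using C(2)[of w] by (auto simp: f_def fun_eq_iff)
      then have "?E (f u) = 1 - ?E (\<lambda>\<omega>. of_bool (\<omega> (u, Mark t) < max_prb u))"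
        by (simp add: Bochner_Integration.integral_diff)
      also have "?E (\<lambda>\<omega>. of_bool (\<omega> (u, Mark t) < max_prb u)) = max_prb u"
        using coins[OF w, of u] u by (intro expect_below Suc_t_dyadic max_prb_dyadic) auto
      finally show "?E (f u) = 1 - max_prb u" .
    qed
    also have "p w * exp (- 60) \<le> p w * (\<Prod>u\<in>C w. 1 - max_prb u)"
    proof (rule mult_left_mono)
      have "(\<Sum>u\<in>C w. max_prb u) \<le> (\<Sum>u\<in>nbrs G w \<inter> remaining s \<union> L. max_prb u)"
        using fin_L mb by (intro sum_mono2) (auto simp: C_def)
      also have "\<dots> \<le> (\<Sum>u\<in>nbrs G w \<inter> remaining s. max_prb u) + (\<Sum>u\<in>L. max_prb u)"
        using fin_L mb by (subst sum.union_inter[symmetric]) (auto intro!: sum_nonneg)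
      also have "\<dots> \<le> 2 * deg w + 2 * sum (prb s) L"
        unfolding nbr_sum_def sum_distrib_left by (intro add_mono sum_mono mb)
      also have "\<dots> \<le> 30" using L(4)[OF w] L(5) by simp
      finally have "exp (- 60) \<le> exp (\<Sum>u\<in>C w. - 2 * max_prb u)"
        by (simp add: sum_distrib_left[symmetric] sum_negf)
      also have "\<dots> = (\<Prod>u\<in>C w. exp (- 2 * max_prb u))" by (rule exp_sum[OF C(1)])
      also have "\<dots> \<le> (\<Prod>u\<in>C w. 1 - max_prb u)" using mb by (intro prod_mono conjI exp_ge_zero exp_le_one_minus)
      finally show "exp (- 60) \<le> (\<Prod>u\<in>C w. 1 - max_prb u)" .
      show "0 \<le> p w" using new_prb_bounds(1)[of w \<omega>] prb_bounds[of w] by (simp add: p_def)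
    qed
    finally show ?thesis .
  qed
  have "?E (\<lambda>\<omega>. of_bool (\<not> covering \<omega> v)) \<le> ?E (\<lambda>\<omega>'. 1 - (\<Sum>w\<in>L. of_bool (W w \<omega>')))"
  proof (intro expect_mono finite_q finite_coins)
    fix \<omega>' assume \<omega>': "\<omega>' \<in> set_pmf (resample q \<omega> ?J)"
    have est: "est \<omega>' w = est \<omega> w" for w
      by (intro est_cong, subst set_resample_outside[OF finite_coins(2) \<omega>']) (auto simp: mark_coins_def)
    have uniq: "w = w'" if "w \<in> L" "w' \<in> L" "W w \<omega>'" "W w' \<omega>'" for w w'
    proof (rule ccontr)
      assume "w \<noteq> w'"
      then have "max_prb w' \<le> \<omega>' (w', Mark t)" using that by (auto simp: W_def C_def)
      also have "\<dots> < p w'" using that by (simp add: W_def)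
      also have "\<dots> \<le> max_prb w'" by (simp add: p_def new_prb_le_max)
      finally show False by simp
    qed
    show "of_bool (\<not> covering \<omega>' v) \<le> (1 - (\<Sum>w\<in>L. of_bool (W w \<omega>')) :: real)"
    proof (cases "\<exists>w\<in>L. W w \<omega>'")
      case True
      then obtain w where w: "w \<in> L" "W w \<omega>'" by blast
      have "(\<Sum>w\<in>L. of_bool (W w \<omega>')) = (\<Sum>w'\<in>L. of_bool (w' = w) :: real)"
        using uniq w by (intro sum.cong) auto
      moreover have "\<dots> = 1" using w fin_L by (simp add: of_bool_def)
      moreover have "covering \<omega>' v"
        unfolding covering_def
      proof (intro bexI[of _ w] conjI)
        show "\<not> t \<le> stall \<omega>' w" using L(3)[OF w(1)] stall_cong[OF est] by simp
        show "\<omega>' (w, Mark t) < new_prb \<omega>' w" using w new_prb_cong[OF est] by (simp add: W_def p_def)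
        show "\<forall>u\<in>nbrs G w \<inter> remaining s. max_prb u \<le> \<omega>' (u, Mark t)"
          using w not_self_nbr by (auto simp: W_def C_def)
      qed (use w L in auto)
      ultimately show ?thesis by simp
    next
      case False
      then have "(\<Sum>w\<in>L. of_bool (W w \<omega>')) = (0::real)" by (intro sum.neutral) auto
      then show ?thesis by simp
    qed
  qed
  also have "\<dots> = ?E (\<lambda>_. 1) - ?E (\<lambda>\<omega>'. \<Sum>w\<in>L. of_bool (W w \<omega>'))"
    by (intro Bochner_Integration.integral_diff integrable_resample finite_q finite_coins)
  also have "?E (\<lambda>\<omega>'. \<Sum>w\<in>L. of_bool (W w \<omega>')) = (\<Sum>w\<in>L. ?E (\<lambda>\<omega>. of_bool (W w \<omega>)))"
    by (intro Bochner_Integration.integral_sum integrable_resample finite_q finite_coins)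
  also have "?E (\<lambda>_. 1) - (\<Sum>w\<in>L. ?E (\<lambda>\<omega>. of_bool (W w \<omega>))) \<le> 1 - (\<Sum>w\<in>L. p w * exp (- 60))"
    using sum_mono[OF prob_W, of L "\<lambda>w. w"] by simp
  also have "\<dots> \<le> 1 - exp (- 60) / 2560"
    using mult_right_mono[OF L(6), of "exp (- 60)"] by (simp add: sum_distrib_right[symmetric])
  finally show ?thesis .
qed

definition round_coins where "round_coins v = sample_coins v \<union> mark_coins v"

text \<open>The marks are averaged first, for fixed samples: the samples already determine the new
  potential, accuracy and the golden sets, and only \<open>covering\<close> still depends on the
  marks. The exponent 8 turns the rise by 7 in a golden iteration into a decrease by 1.\<close>

lemma round_potential:
  assumes v: "v \<in> remaining s" and \<beta>: "1 < \<beta>" "\<beta> powr 8 * (1 - exp (- 60) / 2560) \<le> 1"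
  shows "expect q \<omega> (round_coins v) (\<lambda>\<omega>. of_bool (\<not> covering \<omega> v) * \<beta> powr new_pot \<omega> v)
    \<le> \<beta> powr pot v * (1 / \<beta> + (\<Delta> + 1) * (1 / 4) ^ k * \<beta> powr (7 + log 2 \<Delta>))"
proof -
  let ?F = "\<lambda>\<omega>. of_bool (\<not> covering \<omega> v) * \<beta> powr new_pot \<omega> v"
  let ?E = "expect q \<omega> (sample_coins v)"
  let ?b = "\<beta> powr (pot v + 7 + log 2 \<Delta>)"
  have "expect q \<omega> (round_coins v) ?F = ?E (\<lambda>\<omega>. expect q \<omega> (mark_coins v) ?F)"
    unfolding round_coins_def
    by (intro expect_Un finite_q finite_coins) (auto simp: sample_coins_def mark_coins_def)
  also have "\<dots> \<le> ?E (\<lambda>\<omega>. \<beta> powr (pot v - 1) + of_bool (\<not> accurate \<omega> v) * ?b)"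
  proof (intro expect_mono finite_q finite_coins)
    fix \<omega>
    let ?N = "\<lambda>\<omega>. of_bool (\<not> covering \<omega> v) :: real"
    have "expect q \<omega> (mark_coins v) ?F = expect q \<omega> (mark_coins v) (\<lambda>\<omega>'. ?N \<omega>' * \<beta> powr new_pot \<omega> v)"
    proof (intro expect_cong finite_q finite_coins)
      fix \<omega>' assume "\<omega>' \<in> set_pmf (resample q \<omega> (mark_coins v))"
      then have "new_pot \<omega>' v = new_pot \<omega> v"
        by (intro new_pot_cong est_cong, subst set_resample_outside[of "mark_coins v"])
          (auto simp: mark_coins_def finite_two_hop)
      then show "?F \<omega>' = ?N \<omega>' * \<beta> powr new_pot \<omega> v" by simp
    qed
    then have *: "expect q \<omega> (mark_coins v) ?F = expect q \<omega> (mark_coins v) ?N * \<beta> powr new_pot \<omega> v" by simp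
    have N: "expect q \<omega> (mark_coins v) ?N \<le> 1" by (intro expect_le_const finite_q finite_coins) auto
    have N0: "0 \<le> expect q \<omega> (mark_coins v) ?N" by (intro expect_nonneg finite_q finite_coins) auto
    show "expect q \<omega> (mark_coins v) ?F \<le> \<beta> powr (pot v - 1) + of_bool (\<not> accurate \<omega> v) * ?b"
    proof (cases "accurate \<omega> v")
      case True
      from accurate_round[OF this v] have "expect q \<omega> (mark_coins v) ?F \<le> \<beta> powr (pot v - 1)"
      proof (elim disjE exE)
        assume "new_pot \<omega> v \<le> pot v - 1"
        then have "expect q \<omega> (mark_coins v) ?N * \<beta> powr new_pot \<omega> v \<le> 1 * \<beta> powr (pot v - 1)"
          using N N0 \<beta> by (intro mult_mono powr_mono) auto
        then show ?thesis using * by simp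
      next
        fix L assume "golden \<omega> v L"
        then have "expect q \<omega> (mark_coins v) ?N * \<beta> powr new_pot \<omega> v
            \<le> (1 - exp (- 60) / 2560) * \<beta> powr (pot v + 7)"
          using N0 \<beta> new_pot_le_accurate[OF True]
          by (intro mult_mono powr_mono not_covering_prob) (auto intro: order_trans[of _ 1])
        also have "\<dots> = \<beta> powr (pot v - 1) * (\<beta> powr 8 * (1 - exp (- 60) / 2560))"
        proof -
          have "\<beta> powr (pot v + 7) = \<beta> powr (pot v - 1) * \<beta> powr 8"
            unfolding powr_add[symmetric] by (simp add: add.commute)
          then show ?thesis by simp
        qed
        also have "\<dots> \<le> \<beta> powr (pot v - 1)" using \<beta> by (intro mult_left_le) auto
        finally show ?thesis using * by simp
      qed
      then show ?thesis using True by simp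
    next
      case False
      have "expect q \<omega> (mark_coins v) ?N * \<beta> powr new_pot \<omega> v \<le> 1 * ?b"
        using N N0 \<beta> new_pot_le[of \<omega> v] by (intro mult_mono powr_mono) auto
      then show ?thesis using False * \<beta> by (simp add: add_increasing)
    qed
  qed
  also have "\<dots> = ?E (\<lambda>_. \<beta> powr (pot v - 1)) + ?E (\<lambda>\<omega>. of_bool (\<not> accurate \<omega> v) * ?b)"
    by (intro Bochner_Integration.integral_add integrable_resample finite_q finite_coins)
  also have "\<dots> = \<beta> powr (pot v - 1) + ?E (\<lambda>\<omega>. of_bool (\<not> accurate \<omega> v)) * ?b"
    by (intro arg_cong2[where f = "(+)"] integral_mult_left_zero) simp
  also have "\<dots> \<le> \<beta> powr (pot v - 1) + ((\<Delta> + 1) * (1 / 4) ^ k) * ?b"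
    by (intro add_left_mono mult_right_mono not_accurate_prob) auto
  also have "\<dots> = \<beta> powr pot v * (1 / \<beta> + (\<Delta> + 1) * (1 / 4) ^ k * \<beta> powr (7 + log 2 \<Delta>))"
  proof -
    have 1: "\<beta> powr (pot v - 1) = \<beta> powr pot v * (1 / \<beta>)" using \<beta> by (simp add: powr_diff)
    have 2: "?b = \<beta> powr pot v * \<beta> powr (7 + log 2 \<Delta>)" by (simp only: add.assoc powr_add)
    have 3: "x * c + d * (x * y) = x * (c + d * y)" for x y c d :: real
      by (simp add: algebra_simps)
    show ?thesis unfolding 1 2 by (rule 3)
  qed
  finally show ?thesis .
qed

end

section \<open>The whole execution\<close>

definition potential :: "('a, 'b) pre_digraph \<Rightarrow> nat \<Rightarrow> 'a state \<Rightarrow> 'a \<Rightarrow> real" where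
  "potential G t s v = psi (nbr_sum G s (prb s) v) (prb s v) (real (stall_end s v - t))"

lemma finite_coin_set: "finite (coins T k)"
proof -
  have "coins T k = (\<lambda>(t, i). Sample t i) ` ({1..T} \<times> {..<k}) \<union> Mark ` {1..T}"
    by (auto simp: coins_def)
  then show ?thesis by simp
qed

section \<open>From the one-sided bounds to the actual iteration\<close>

context mis_round_coins
begin

definition marked where
  "marked \<omega> = {v \<in> remaining s. \<not> t \<le> stall \<omega> v \<and> \<omega> (v, Mark t) < new_prb \<omega> v}"
definition joining where "joining \<omega> = {v \<in> marked \<omega>. nbrs G v \<inter> marked \<omega> = {}}"

lemma iteration_eq:
  "iteration G \<Delta> T k \<omega> t s =
    \<lparr> remaining = remaining s - (joining \<omega> \<union> (\<Union>v\<in>joining \<omega>. nbrs G v)),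
      indep_set = indep_set s \<union> joining \<omega>, prb = new_prb \<omega>, stall_end = stall \<omega> \<rparr>"
  unfolding iteration_def Let_def joining_def marked_def new_prb_def stall_def est_def ..

text \<open>An iteration reads its coins only through comparisons with dyadic thresholds. This is
  what permits rounding them to a grid.\<close>

lemma iteration_cong:
  assumes "\<And>u i j. u \<in> verts G \<Longrightarrow> i < k \<Longrightarrow> j \<in> {1..T + 1} \<Longrightarrow>
      \<omega> (u, Sample t i) < (1 / 2) ^ j \<longleftrightarrow> \<omega>' (u, Sample t i) < (1 / 2) ^ j"
    and "\<And>u j. u \<in> verts G \<Longrightarrow> j \<in> {1..T + 1} \<Longrightarrow>
      \<omega> (u, Mark t) < (1 / 2) ^ j \<longleftrightarrow> \<omega>' (u, Mark t) < (1 / 2) ^ j"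
  shows "iteration G \<Delta> T k \<omega> t s = iteration G \<Delta> T k \<omega>' t s"
proof -
  have est: "est \<omega> = est \<omega>'"
  proof (intro ext est_cong)
    fix w u i assume "u \<in> nbrs G w" "i < k"
    moreover obtain j where "j \<in> {1..T + 1}" "prb s u = (1 / 2) ^ j" using prb_dyadic by blast
    ultimately show "\<omega> (u, Sample t i) < prb s u \<longleftrightarrow> \<omega>' (u, Sample t i) < prb s u"
      using assms(1)[of u i j] nbrs_subset by auto
  qed
  have stall: "stall \<omega> = stall \<omega>'" and new_prb: "new_prb \<omega> = new_prb \<omega>'"
    using stall_cong[of \<omega> _ \<omega>'] new_prb_cong[of \<omega> _ \<omega>'] by (simp_all add: fun_eq_iff est)
  have "\<omega> (u, Mark t) < new_prb \<omega> u \<longleftrightarrow> \<omega>' (u, Mark t) < new_prb \<omega> u" if "u \<in> remaining s" for u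
  proof -
    obtain j where "j \<in> {1..T + 1}" "new_prb \<omega> u = (1 / 2) ^ j"
      using Suc_t_dyadic[OF new_prb_dyadic] by blast
    then show ?thesis using assms(2)[of u j] that remaining_subset by auto
  qed
  then have marked: "marked \<omega> = marked \<omega>'" unfolding marked_def stall new_prb by blast
  show ?thesis unfolding iteration_eq joining_def marked stall new_prb ..
qed

text \<open>A coin of at least \<open>max_prb u\<close> is at least the actual marking probability
  of \<open>u\<close>, so no neighbour of the witness \<open>w\<close> is marked and
  \<open>w\<close> joins.\<close>

lemma covering_removes:
  assumes "covering \<omega> v"
  shows "v \<notin> remaining (iteration G \<Delta> T k \<omega> t s)"
proof -
  obtain w where w: "w \<in> insert v (nbrs G v)" "w \<in> marked \<omega>"
    "\<And>u. u \<in> nbrs G w \<inter> remaining s \<Longrightarrow> max_prb u \<le> \<omega> (u, Mark t)"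
    using assms unfolding covering_def marked_def by blast
  have "u \<notin> marked \<omega>" if "u \<in> nbrs G w" for u
    using w(3)[of u] that new_prb_le_max[of \<omega> u] by (auto simp: marked_def)
  then have "w \<in> joining \<omega>" using w(2) by (auto simp: joining_def)
  then show ?thesis using w(1) nbrs_sym[of w v] by (auto simp: iteration_eq)
qed

lemma potential_iteration_le: "potential G t (iteration G \<Delta> T k \<omega> t s) v \<le> new_pot \<omega> v"
proof -
  have "0 \<le> new_prb \<omega> u" for u using new_prb_bounds(1)[of u \<omega>] prb_bounds(1)[of u] by linarith
  then have "nbr_sum G (iteration G \<Delta> T k \<omega> t s) (new_prb \<omega>) v \<le> nbr_sum G s (new_prb \<omega>) v"
    unfolding nbr_sum_def by (intro sum_mono2) (auto simp: iteration_eq)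
  then show ?thesis
    unfolding potential_def new_pot_def by (simp add: iteration_eq psi_mono)
qed

lemma pot_eq: "pot v = potential G (t - 1) s v"
  by (simp add: pot_def potential_def)

lemma determined_by_round_coins:
  "determined_by (\<lambda>\<omega>. of_bool (\<not> covering \<omega> v) * \<beta> powr new_pot \<omega> v :: real) (round_coins v)"
  unfolding determined_by_def
proof (intro allI impI)
  fix \<omega> \<omega>' :: "'a \<times> coin \<Rightarrow> real" assume eq: "\<forall>c\<in>round_coins v. \<omega> c = \<omega>' c"
  have "est \<omega> w = est \<omega>' w" if "w \<in> insert v (nbrs G v)" for w
  proof (rule est_cong)
    fix u i assume "u \<in> nbrs G w" "i < k"
    then have "(u, Sample t i) \<in> round_coins v"
      using that by (auto simp: round_coins_def sample_coins_def two_hop_def)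
    then show "\<omega> (u, Sample t i) < prb s u \<longleftrightarrow> \<omega>' (u, Sample t i) < prb s u" using eq by simp
  qed
  moreover have "\<omega> (u, Mark t) = \<omega>' (u, Mark t)" if "u \<in> two_hop G v" for u
    using that eq by (auto simp: round_coins_def mark_coins_def)
  ultimately have "covering \<omega> v \<longleftrightarrow> covering \<omega>' v" "new_pot \<omega> v = new_pot \<omega>' v"
    using covering_cong new_pot_cong by blast+
  then show "of_bool (\<not> covering \<omega> v) * \<beta> powr new_pot \<omega> v = of_bool (\<not> covering \<omega>' v) * \<beta> powr new_pot \<omega>' v"
    by simp
qed

end

context mis_coins
begin

abbreviation run where "run \<equiv> state_after G \<Delta> T k"

lemma run_invariant:
  assumes "t \<le> T"
  shows "(\<forall>v. \<exists>j\<in>{1..t + 1}. prb (run \<omega> t) v = (1 / 2) ^ j) \<and> remaining (run \<omega> t) \<subseteq> verts G"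
  using assms
proof (induction t)
  case (Suc t)
  interpret mis_round_coins G \<Delta> T k "Suc t" "run \<omega> t" q
    using Suc by unfold_locales auto
  show ?case using new_prb_dyadic remaining_subset by (auto simp: iteration_eq)
qed auto

lemma round_coins: "t < T \<Longrightarrow> mis_round_coins G \<Delta> T k (Suc t) (run \<omega> t) q"
  using run_invariant[of t \<omega>] by unfold_locales auto

lemma run_cong:
  assumes "t \<le> T"
    and "\<And>u t' i j. u \<in> verts G \<Longrightarrow> t' \<in> {1..t} \<Longrightarrow> i < k \<Longrightarrow> j \<in> {1..T + 1} \<Longrightarrow>
      \<omega> (u, Sample t' i) < (1 / 2) ^ j \<longleftrightarrow> \<omega>' (u, Sample t' i) < (1 / 2) ^ j"
    and "\<And>u t' j. u \<in> verts G \<Longrightarrow> t' \<in> {1..t} \<Longrightarrow> j \<in> {1..T + 1} \<Longrightarrow>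
      \<omega> (u, Mark t') < (1 / 2) ^ j \<longleftrightarrow> \<omega>' (u, Mark t') < (1 / 2) ^ j"
  shows "run \<omega> t = run \<omega>' t"
  using assms
proof (induction t)
  case (Suc t)
  interpret mis_round_coins G \<Delta> T k "Suc t" "run \<omega> t" q
    using Suc.prems(1) by (intro round_coins) simp
  have "run \<omega> t = run \<omega>' t" using Suc.prems by (intro Suc.IH) auto
  moreover have "iteration G \<Delta> T k \<omega> (Suc t) (run \<omega> t) = iteration G \<Delta> T k \<omega>' (Suc t) (run \<omega> t)"
    using Suc.prems by (intro iteration_cong) auto
  ultimately show ?case by simp
qed simp

section \<open>Contraction of the restricted potential over all iterations\<close>

definition survival :: "real \<Rightarrow> nat \<Rightarrow> ('a \<times> coin \<Rightarrow> real) \<Rightarrow> 'a \<Rightarrow> real" where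
  "survival \<beta> t \<omega> v = of_bool (v \<in> remaining (run \<omega> t)) * \<beta> powr potential G t (run \<omega> t) v"

text \<open>The first term accounts for accurate iterations, golden or not. The second is the chance
  that one of at most \<open>\<Delta> + 1\<close> estimates fails, times the largest possible growth
  of the exponential potential.\<close>

definition contraction :: "real \<Rightarrow> real" where
  "contraction \<beta> = 1 / \<beta> + (\<Delta> + 1) * (1 / 4) ^ k * \<beta> powr (7 + log 2 \<Delta>)"

context
  fixes \<beta> :: real and S N :: "'a set"
  assumes \<beta>: "1 < \<beta>" "\<beta> powr 8 * (1 - exp (- 60) / 2560) \<le> 1"
    and S: "finite S" "disjoint_family_on (two_hop G) S" "\<And>v. v \<in> S \<Longrightarrow> two_hop G v \<subseteq> N"
    and N: "finite N"
begin

abbreviation all_coins :: "('a \<times> coin) set" where "all_coins \<equiv> N \<times> coins T k"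

lemma finite_all_coins: "finite all_coins"
  using N finite_coin_set by (rule finite_cartesian_product)

text \<open>The coins of iteration \<open>Suc t\<close> are redrawn with all others held fixed. As
  the state after \<open>t\<close> iterations does not read them, it is a constant, and the
  majorants of the factors for distinct nodes depend on disjoint sets of fresh coins.\<close>

lemma survival_step:
  assumes "t < T"
  shows "expect q \<omega> all_coins (\<lambda>\<omega>. \<Prod>v\<in>S. survival \<beta> (Suc t) \<omega> v)
    \<le> contraction \<beta> ^ card S * expect q \<omega> all_coins (\<lambda>\<omega>. \<Prod>v\<in>S. survival \<beta> t \<omega> v)"
proof -
  define A where "A = N \<times> ({Sample (Suc t) i | i. i < k} \<union> {Mark (Suc t)})"
  have A: "A \<subseteq> all_coins" using assms by (auto simp: A_def coins_def)
  have fin_A: "finite A" using finite_subset[OF A finite_all_coins] .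
  have step: "expect q \<omega> A (\<lambda>\<omega>. \<Prod>v\<in>S. survival \<beta> (Suc t) \<omega> v)
      \<le> contraction \<beta> ^ card S * (\<Prod>v\<in>S. survival \<beta> t \<omega> v)" for \<omega>
  proof -
    define s where "s = run \<omega> t"
    interpret R: mis_round_coins G \<Delta> T k "Suc t" s q
      unfolding s_def using assms by (rule round_coins)
    define F where "F v \<omega>' = of_bool (v \<in> remaining s) * (of_bool (\<not> R.covering \<omega>' v) * \<beta> powr R.new_pot \<omega>' v)"
      for v \<omega>'
    have det: "determined_by (F v) (R.round_coins v)" for v
      unfolding F_def by (intro determined_by_comp[OF R.determined_by_round_coins, where F = "\<lambda>x. c * x" for c])
    have sub: "R.round_coins v \<subseteq> A" if "v \<in> S" for v
      using S(3)[OF that] by (auto simp: R.round_coins_def R.sample_coins_def R.mark_coins_def A_def)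
    have disj: "disjoint_family_on R.round_coins S"
      using S(2) by (fastforce simp: disjoint_family_on_def R.round_coins_def R.sample_coins_def R.mark_coins_def)
    have "expect q \<omega> A (\<lambda>\<omega>. \<Prod>v\<in>S. survival \<beta> (Suc t) \<omega> v) \<le> expect q \<omega> A (\<lambda>\<omega>. \<Prod>v\<in>S. F v \<omega>)"
    proof (intro expect_mono finite_q fin_A prod_mono conjI)
      fix \<omega>' v assume \<omega>': "\<omega>' \<in> set_pmf (resample q \<omega> A)"
      show "0 \<le> survival \<beta> (Suc t) \<omega>' v" by (simp add: survival_def)
      have eq: "\<omega>' (u, Sample t' i) = \<omega> (u, Sample t' i)" "\<omega>' (u, Mark t') = \<omega> (u, Mark t')" if "t' \<le> t" for u t' i
        using that by (auto intro!: set_resample_outside[OF fin_A \<omega>'] simp: A_def)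
      have "run \<omega>' t = s"
        unfolding s_def using assms by (intro run_cong) (auto simp: eq)
      then have run: "run \<omega>' (Suc t) = iteration G \<Delta> T k \<omega>' (Suc t) s" by simp
      show "survival \<beta> (Suc t) \<omega>' v \<le> F v \<omega>'"
      proof (cases "v \<in> remaining (run \<omega>' (Suc t))")
        case True
        then have "v \<in> remaining s" "\<not> R.covering \<omega>' v"
          using R.covering_removes[of \<omega>' v] unfolding run by (auto simp: R.iteration_eq)
        then show ?thesis
          using R.potential_iteration_le[of \<omega>' v] \<beta> True unfolding survival_def F_def run
          by (auto intro: powr_mono)
      qed (simp add: survival_def F_def)
    qed
    also have "\<dots> = (\<Prod>v\<in>S. expect q \<omega> A (F v))"
      using S(1) det sub disj by (intro expect_prod[where A = R.round_coins] finite_q fin_A) auto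
    also have "\<dots> \<le> (\<Prod>v\<in>S. contraction \<beta> * survival \<beta> t \<omega> v)"
    proof (intro prod_mono conjI)
      fix v assume v: "v \<in> S"
      show "0 \<le> expect q \<omega> A (F v)" by (intro expect_nonneg finite_q fin_A) (simp add: F_def)
      have "expect q \<omega> A (F v) = expect q \<omega> (R.round_coins v) (F v)"
        by (rule expect_determined_cong[OF finite_q fin_A sub[OF v] det])
      also have "\<dots> = of_bool (v \<in> remaining s) * expect q \<omega> (R.round_coins v)
          (\<lambda>\<omega>. of_bool (\<not> R.covering \<omega> v) * \<beta> powr R.new_pot \<omega> v)"
        unfolding F_def by simp
      also have "\<dots> \<le> of_bool (v \<in> remaining s) * (\<beta> powr R.pot v * contraction \<beta>)"
        using R.round_potential[OF _ \<beta>, of v \<omega>] by (cases "v \<in> remaining s") (simp_all add: contraction_def)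
      also have "\<dots> = contraction \<beta> * survival \<beta> t \<omega> v"
        by (simp add: survival_def R.pot_eq s_def[symmetric])
      finally show "expect q \<omega> A (F v) \<le> contraction \<beta> * survival \<beta> t \<omega> v" .
    qed
    finally show ?thesis by (simp add: prod.distrib)
  qed
  have "expect q \<omega> all_coins (\<lambda>\<omega>. \<Prod>v\<in>S. survival \<beta> (Suc t) \<omega> v)
      = expect q \<omega> all_coins (\<lambda>\<omega>'. expect q \<omega>' A (\<lambda>\<omega>. \<Prod>v\<in>S. survival \<beta> (Suc t) \<omega> v))"
    by (rule expect_expect[OF finite_q finite_all_coins A])
  also have "\<dots> \<le> expect q \<omega> all_coins (\<lambda>\<omega>. contraction \<beta> ^ card S * (\<Prod>v\<in>S. survival \<beta> t \<omega> v))"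
    by (intro expect_mono finite_q finite_all_coins step)
  finally show ?thesis by simp
qed

lemma survival_prob:
  "measure_pmf.prob (resample q \<eta> all_coins) {\<omega>. S \<subseteq> remaining (run \<omega> T)}
    \<le> (contraction \<beta> ^ T * \<beta> powr (30 + 6 * log 2 \<Delta>)) ^ card S"
proof -
  let ?E = "expect q \<eta> all_coins"
  have c0: "0 \<le> contraction \<beta>" using \<beta> by (simp add: contraction_def)
  have "?E (\<lambda>\<omega>. \<Prod>v\<in>S. survival \<beta> t \<omega> v) \<le> (contraction \<beta> ^ t * \<beta> powr (30 + 6 * log 2 \<Delta>)) ^ card S"
    if "t \<le> T" for t
    using that
  proof (induction t)
    case 0
    \<comment> \<open>At the start \<open>p = 1 / 2\<close> and nobody stalls, so only
      \<open>6 * phi\<close> remains; degree at most \<open>\<Delta> / 2\<close> bounds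
      \<open>phi\<close> by \<open>log 2 (32 * \<Delta>) = 5 + log 2 \<Delta>\<close>.\<close>
    have "survival \<beta> 0 \<omega> v \<le> \<beta> powr (30 + 6 * log 2 \<Delta>)" for \<omega> v
    proof -
      let ?d = "nbr_sum G (run \<omega> 0) (prb (run \<omega> 0)) v"
      have "?d = real (card (nbrs G v \<inter> verts G)) / 2" by (simp add: nbr_sum_def)
      also have "card (nbrs G v \<inter> verts G) \<le> \<Delta>"
        using card_mono[of "nbrs G v" "nbrs G v \<inter> verts G"] card_nbrs[of v] by simp
      finally have "max (64 * ?d) 1 \<le> 32 * real \<Delta>" using Delta_ge by simp
      then have "phi ?d \<le> log 2 (32 * real \<Delta>)"
        unfolding phi_def using Delta_ge by (subst log_le_cancel_iff) auto
      also have "\<dots> = log 2 (2 ^ 5) + log 2 \<Delta>" using Delta_ge by (subst log_mult_pos[symmetric]) auto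
      also have "log 2 (2 ^ 5) = (5::real)" by (subst log_nat_power) auto
      finally have "potential G 0 (run \<omega> 0) v \<le> 30 + 6 * log 2 \<Delta>"
        using phi_nonneg[of ?d] by (simp add: potential_def psi_def)
      then show ?thesis using \<beta> by (auto simp: survival_def intro!: powr_mono)
    qed
    then have "(\<Prod>v\<in>S. survival \<beta> 0 \<omega> v) \<le> (\<beta> powr (30 + 6 * log 2 \<Delta>)) ^ card S" for \<omega>
      using prod_mono[of S "survival \<beta> 0 \<omega>" "\<lambda>_. \<beta> powr (30 + 6 * log 2 \<Delta>)"] by (simp add: survival_def)
    then show ?case by (intro expect_le_const finite_q finite_all_coins) simp
  next
    case (Suc t)
    have "?E (\<lambda>\<omega>. \<Prod>v\<in>S. survival \<beta> (Suc t) \<omega> v)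
        \<le> contraction \<beta> ^ card S * ?E (\<lambda>\<omega>. \<Prod>v\<in>S. survival \<beta> t \<omega> v)"
      using Suc.prems by (intro survival_step) simp
    also have "\<dots> \<le> contraction \<beta> ^ card S * (contraction \<beta> ^ t * \<beta> powr (30 + 6 * log 2 \<Delta>)) ^ card S"
      using Suc c0 by (intro mult_left_mono) auto
    finally show ?case by (simp add: power_mult_distrib mult.assoc)
  qed
  from this[OF order_refl]
  have "?E (\<lambda>\<omega>. \<Prod>v\<in>S. survival \<beta> T \<omega> v) \<le> (contraction \<beta> ^ T * \<beta> powr (30 + 6 * log 2 \<Delta>)) ^ card S" .
  moreover have "?E (\<lambda>\<omega>. of_bool (S \<subseteq> remaining (run \<omega> T))) \<le> ?E (\<lambda>\<omega>. \<Prod>v\<in>S. survival \<beta> T \<omega> v)"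
  proof (intro expect_mono finite_q finite_all_coins)
    fix \<omega>
    \<comment> \<open>The potential is nonnegative, so every surviving node contributes a factor of
      at least 1 and the product dominates the indicator.\<close>
    have "1 \<le> survival \<beta> T \<omega> v" if "v \<in> remaining (run \<omega> T)" for v
    proof -
      obtain j where j: "j \<in> {1..T + 1}" "prb (run \<omega> T) v = (1 / 2) ^ j"
        using run_invariant[of T \<omega>] by blast
      then have "0 \<le> potential G T (run \<omega> T) v"
        unfolding potential_def using power_decreasing[of 1 j "1 / 2 :: real"] by (intro psi_nonneg) auto
      then show ?thesis using that \<beta> by (simp add: survival_def ge_one_powr_ge_zero)
    qed
    then show "of_bool (S \<subseteq> remaining (run \<omega> T)) \<le> (\<Prod>v\<in>S. survival \<beta> T \<omega> v)"
      by (auto simp: of_bool_def survival_def intro!: prod_ge_1 prod_nonneg)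
  qed
  ultimately show ?thesis by (subst prob_expect[OF finite_q finite_all_coins]) simp
qed

end

end

section \<open>Discretising the coins\<close>

definition grid_index :: "nat \<Rightarrow> real \<Rightarrow> nat" where
  "grid_index m x = min (2 ^ m - 1) (nat \<lfloor>x * 2 ^ m\<rfloor>)"

definition to_grid :: "nat \<Rightarrow> real \<Rightarrow> real" where
  "to_grid m x = real (grid_index m x) / 2 ^ m"

definition grid_pmf :: "nat \<Rightarrow> real pmf" where
  "grid_pmf m = map_pmf (\<lambda>i. real i / 2 ^ m) (pmf_of_set {..<2 ^ m})"

abbreviation unif :: "real measure" where "unif \<equiv> uniform_measure lborel {0..1}"

lemma half_power_grid: "j \<le> m \<Longrightarrow> (1 / 2) ^ j = real (2 ^ (m - j)) / (2 ^ m :: real)"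
proof -
  assume "j \<le> m"
  then have "(2::real) ^ m = 2 ^ (m - j) * 2 ^ j" by (simp add: power_add[symmetric])
  then show ?thesis by (simp add: power_one_over field_simps)
qed

text \<open>The threshold is a multiple of the cell width because \<open>j \<le> m\<close>, and it
  lies at or below the start of the last cell because \<open>1 \<le> j\<close>; so neither the cap
  in \<open>grid_index\<close> nor the truncation of negative values affects the comparison, for any
  real \<open>x\<close>.\<close>

lemma to_grid_less_iff:
  assumes "j \<in> {1..m}"
  shows "to_grid m x < (1 / 2) ^ j \<longleftrightarrow> x < (1 / 2) ^ j"
proof -
  define a :: nat where "a = 2 ^ (m - j)"
  have half: "(1 / 2) ^ j = real a / (2 ^ m :: real)" using assms half_power_grid[of j m] by (simp add: a_def)
  have "a < 2 ^ m" using assms unfolding a_def by (intro power_strict_increasing) auto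
  then have a: "1 \<le> a" "a \<le> 2 ^ m - 1" by (simp add: a_def, linarith)
  have "to_grid m x < (1 / 2) ^ j \<longleftrightarrow> grid_index m x < a"
    unfolding half to_grid_def by (simp add: divide_less_cancel)
  also have "\<dots> \<longleftrightarrow> nat \<lfloor>x * 2 ^ m\<rfloor> < a" using a(2) by (auto simp: grid_index_def)
  also have "\<dots> \<longleftrightarrow> \<lfloor>x * 2 ^ m\<rfloor> < int a" using a(1) by auto
  also have "\<dots> \<longleftrightarrow> x * 2 ^ m < real a" by (simp add: floor_less_iff)
  also have "\<dots> \<longleftrightarrow> x < (1 / 2) ^ j" unfolding half by (simp add: field_simps)
  finally show ?thesis .
qed

lemma finite_grid_pmf: "finite (set_pmf (grid_pmf m))"
  by (auto simp: grid_pmf_def set_pmf_of_set lessThan_empty_iff)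

lemma pmf_grid:
  assumes "i < 2 ^ m"
  shows "pmf (grid_pmf m) (real i / 2 ^ m) = 1 / 2 ^ m"
proof -
  have "pmf (grid_pmf m) (real i / 2 ^ m) = pmf (pmf_of_set {..<2 ^ m}) i"
    unfolding grid_pmf_def by (intro pmf_map_inj') (auto simp: inj_def)
  then show ?thesis using assms by (simp add: lessThan_empty_iff)
qed

lemma set_grid_pmf: "set_pmf (grid_pmf m) = (\<lambda>i. real i / 2 ^ m) ` {..<2 ^ m}"
  by (simp add: grid_pmf_def lessThan_empty_iff)

lemma prob_grid_pmf:
  assumes "j \<in> {1..m}"
  shows "measure_pmf.prob (grid_pmf m) {x. x < (1 / 2) ^ j} = (1 / 2) ^ j"
proof -
  have half: "(1 / 2) ^ j = real (2 ^ (m - j)) / (2 ^ m :: real)" using assms half_power_grid by auto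
  have "measure_pmf.prob (grid_pmf m) {x. x < (1 / 2) ^ j}
      = measure_pmf.prob (pmf_of_set {..<2 ^ m}) {i. real i / 2 ^ m < (1 / 2) ^ j}"
    by (simp add: grid_pmf_def vimage_def)
  also have "{i. real i / 2 ^ m < (1 / 2) ^ j} = {..<2 ^ (m - j)}"
    unfolding half by (auto simp: divide_less_cancel simp flip: of_nat_power) 
  also have "measure_pmf.prob (pmf_of_set {..<2 ^ m :: nat}) {..<2 ^ (m - j)} = (1 / 2) ^ j"
  proof -
    have "{..<2 ^ m} \<inter> {..<2 ^ (m - j)} = {..<2 ^ (m - j) :: nat}"
      using power_increasing[of "m - j" m "2::nat"] by (intro Int_absorb1) simp
    moreover have "measure_pmf.prob (pmf_of_set {..<2 ^ m :: nat}) {..<2 ^ (m - j)}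
        = real (card ({..<2 ^ m} \<inter> {..<2 ^ (m - j) :: nat})) / real (card {..<2 ^ m :: nat})"
      by (rule measure_pmf_of_set) (simp_all add: lessThan_empty_iff)
    ultimately show ?thesis unfolding half by (simp only: card_lessThan of_nat_power of_nat_numeral)
  qed
  finally show ?thesis .
qed

lemma prob_space_unif: "prob_space unif"
  by (intro prob_space_uniform_measure) auto

lemma measurable_grid_index [measurable]: "grid_index m \<in> borel \<rightarrow>\<^sub>M count_space UNIV"
  unfolding grid_index_def by measurable

text \<open>Within the unit interval the cells are half open, except for the last one, which also
  receives the point 1 through the cap; hence the case distinction.\<close>

lemma measure_unif_grid_index:
  assumes i: "i < 2 ^ m"
  shows "measure unif {x. grid_index m x = i} = 1 / 2 ^ m"
proof -
  have meas: "{x. grid_index m x = i} \<in> sets lborel"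
    using measurable_sets[OF measurable_grid_index, of "{i}" m] by (simp add: vimage_def)
  have "measure unif {x. grid_index m x = i} = measure lborel ({0..1} \<inter> {x. grid_index m x = i})"
    using meas by (subst measure_uniform_measure) auto
  also have "\<dots> = 1 / 2 ^ m"
  proof (cases "i = 2 ^ m - 1")
    case True
    have "{0..1} \<inter> {x. grid_index m x = i} = {real i / 2 ^ m..1}"
    proof (intro set_eqI)
      fix x :: real
      have "grid_index m x = i \<longleftrightarrow> i \<le> nat \<lfloor>x * 2 ^ m\<rfloor>" using True by (auto simp: grid_index_def)
      also have "\<dots> \<longleftrightarrow> real i \<le> x * 2 ^ m" if "0 \<le> x"
        using that by (simp add: le_nat_iff le_floor_iff)
      finally show "x \<in> {0..1} \<inter> {x. grid_index m x = i} \<longleftrightarrow> x \<in> {real i / 2 ^ m..1}"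
        by (cases "0 \<le> x") (auto simp: field_simps intro: order_trans[of 0 "real i / 2 ^ m"] dest: order_trans[of 0 "real i"])
    qed
    then show ?thesis using True by (simp add: field_simps of_nat_diff)
  next
    case False
    then have i': "i + 1 < 2 ^ m" using i by auto
    have between: "(0 \<le> x \<and> x \<le> 1) \<and> Q \<longleftrightarrow> a \<le> x \<and> x < b"
      if "0 \<le> x \<Longrightarrow> Q \<longleftrightarrow> a \<le> x \<and> x < b" "b \<le> 1" "0 \<le> a" for a b x :: real and Q
      using that by (cases "0 \<le> x") auto
    have "{0..1} \<inter> {x. grid_index m x = i} = {real i / 2 ^ m..<real (i + 1) / 2 ^ m}"
    proof (intro set_eqI)
      fix x :: real
      have "grid_index m x = i \<longleftrightarrow> nat \<lfloor>x * 2 ^ m\<rfloor> = i" using i' by (auto simp: grid_index_def min_def)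
      also have "\<dots> \<longleftrightarrow> real i \<le> x * 2 ^ m \<and> x * 2 ^ m < real i + 1" if "0 \<le> x"
        using that by (auto simp: nat_eq_iff floor_eq_iff)
      finally have *: "grid_index m x = i \<longleftrightarrow> real i / 2 ^ m \<le> x \<and> x < real (i + 1) / 2 ^ m" if "0 \<le> x"
        using that by (simp add: field_simps)
      have "real (i + 1) / 2 ^ m \<le> 1" using i' 
        using of_nat_mono[OF less_imp_le[OF i'], where ?'a = real] by (simp add: field_simps)
      moreover have "0 \<le> real i / 2 ^ m" by simp
      ultimately show "x \<in> {0..1} \<inter> {x. grid_index m x = i} \<longleftrightarrow> x \<in> {real i / 2 ^ m..<real (i + 1) / 2 ^ m}"
        using between[of x "grid_index m x = i", OF *]
        unfolding Int_iff mem_Collect_eq atLeastAtMost_iff atLeastLessThan_iff by blast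
    qed
    moreover have "real i / 2 ^ m \<le> real (i + 1) / 2 ^ m" by (intro divide_right_mono) auto
    moreover have "real (i + 1) / 2 ^ m - real i / 2 ^ m = 1 / 2 ^ m" by (simp add: add_divide_distrib)
    ultimately show ?thesis by (simp only: measure_lborel_Ico)
  qed
  finally show ?thesis .
qed

lemma measure_unif_to_grid:
  assumes "y \<in> set_pmf (grid_pmf m)"
  shows "measure unif {x. to_grid m x = y} = pmf (grid_pmf m) y"
proof -
  obtain i where i: "i < 2 ^ m" "y = real i / 2 ^ m" using assms by (auto simp: set_grid_pmf)
  have "{x. to_grid m x = y} = {x. grid_index m x = i}" by (auto simp: i to_grid_def)
  then show ?thesis
    by (simp only: measure_unif_grid_index[OF i(1)]) (simp only: i(2) pmf_grid[OF i(1)])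
qed

lemma measurable_to_grid_eq: "{x. to_grid m x = y} \<in> sets borel"
proof -
  have "{x. to_grid m x = y} = grid_index m -` {i. real i / 2 ^ m = y} \<inter> space borel"
    by (auto simp: to_grid_def)
  then show ?thesis using measurable_sets[OF measurable_grid_index, of "{i. real i / 2 ^ m = y}" m] by simp
qed

lemma to_grid_in_set: "to_grid m x \<in> set_pmf (grid_pmf m)"
  by (auto simp: set_grid_pmf to_grid_def grid_index_def min_less_iff_disj)

text \<open>Rounding partitions the product space into finitely many cylinders, and \<open>E\<close>
  is a union of them; this settles measurability as well. Coordinates outside \<open>J\<close> are
  supplied by \<open>\<eta>\<close>.\<close>

lemma discretise:
  fixes J :: "'c set" and \<eta> :: "'c \<Rightarrow> real" and m :: nat and P :: "('c \<Rightarrow> real) \<Rightarrow> bool"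
  assumes J: "finite J"
  defines "E \<equiv> {\<omega> \<in> space (PiM J (\<lambda>_. unif)). P (override_on \<eta> (to_grid m \<circ> \<omega>) J)}"
  shows "E \<in> sets (PiM J (\<lambda>_. unif))"
    and "measure (PiM J (\<lambda>_. unif)) E = measure_pmf.prob (resample (grid_pmf m) \<eta> J) {\<omega>. P \<omega>}"
proof -
  interpret prob_space unif by (rule prob_space_unif)
  interpret PP: product_prob_space "\<lambda>_. unif" J by standard
  interpret FP: finite_product_prob_space "\<lambda>_. unif" J by standard (rule J)
  let ?M = "PiM J (\<lambda>_. unif)"
  define Y where "Y = {y \<in> PiE_dflt J undefined (\<lambda>_. set_pmf (grid_pmf m)). P (override_on \<eta> y J)}"
  define cyl where "cyl y = PiE J (\<lambda>c. {x. to_grid m x = y c})" for y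
  have fin: "finite Y" 
    unfolding Y_def by (rule finite_subset[OF _ finite_PiE_dflt[of J "\<lambda>_. set_pmf (grid_pmf m)" undefined]])
      (auto simp: J finite_grid_pmf)
  have meas: "cyl y \<in> sets ?M" for y
    unfolding cyl_def using J measurable_to_grid_eq by (intro sets_PiM_I_finite) auto
  have E: "E = (\<Union>y\<in>Y. cyl y)"
  proof (intro equalityI subsetI)
    fix \<omega> assume \<omega>: "\<omega> \<in> E"
    define y where "y c = (if c \<in> J then to_grid m (\<omega> c) else undefined)" for c
    have "override_on \<eta> (to_grid m \<circ> \<omega>) J = override_on \<eta> y J" by (auto simp: y_def override_on_def)
    then have "y \<in> Y" using \<omega> to_grid_in_set by (auto simp: E_def Y_def PiE_dflt_def y_def)
    moreover have "\<omega> \<in> cyl y" using \<omega> by (auto simp: E_def cyl_def y_def space_PiM PiE_def)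
    ultimately show "\<omega> \<in> (\<Union>y\<in>Y. cyl y)" by blast
  next
    fix \<omega> assume "\<omega> \<in> (\<Union>y\<in>Y. cyl y)"
    then obtain y where y: "y \<in> Y" "\<omega> \<in> cyl y" by blast
    have "override_on \<eta> (to_grid m \<circ> \<omega>) J = override_on \<eta> y J"
      using y(2) by (auto simp: cyl_def override_on_def PiE_def Pi_def)
    then show "\<omega> \<in> E" using y by (auto simp: E_def Y_def cyl_def space_PiM PiE_def)
  qed
  show "E \<in> sets ?M" unfolding E using fin meas by auto
  have disj: "disjoint_family_on cyl Y"
  proof (unfold disjoint_family_on_def, intro ballI impI)
    fix y y' assume y: "y \<in> Y" "y' \<in> Y" "y \<noteq> y'"
    then obtain c where "y c \<noteq> y' c" by blast
    with y have "c \<in> J" by (auto simp: Y_def PiE_dflt_def)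
    with \<open>y c \<noteq> y' c\<close> show "cyl y \<inter> cyl y' = {}" by (auto simp: cyl_def PiE_def Pi_def)
  qed
  have "measure ?M E = (\<Sum>y\<in>Y. measure ?M (cyl y))"
    unfolding E using fin meas disj by (intro PP.P.finite_measure_finite_Union) auto
  also have "\<dots> = (\<Sum>y\<in>Y. pmf (Pi_pmf J undefined (\<lambda>_. grid_pmf m)) y)"
  proof (intro sum.cong refl)
    fix y assume y: "y \<in> Y"
    have "measure ?M (cyl y) = (\<Prod>c\<in>J. measure unif {x. to_grid m x = y c})"
      unfolding cyl_def using measurable_to_grid_eq by (intro FP.finite_measure_PiM_emb) auto
    also have "\<dots> = (\<Prod>c\<in>J. pmf (grid_pmf m) (y c))"
      using y by (intro prod.cong measure_unif_to_grid) (auto simp: Y_def PiE_dflt_def)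
    also have "\<dots> = pmf (Pi_pmf J undefined (\<lambda>_. grid_pmf m)) y"
      using y J by (subst pmf_Pi') (auto simp: Y_def PiE_dflt_def)
    finally show "measure ?M (cyl y) = pmf (Pi_pmf J undefined (\<lambda>_. grid_pmf m)) y" .
  qed
  also have "\<dots> = measure_pmf.prob (Pi_pmf J undefined (\<lambda>_. grid_pmf m)) Y"
    by (rule measure_measure_pmf_finite[OF fin, symmetric])
  also have "\<dots> = measure_pmf.prob (Pi_pmf J undefined (\<lambda>_. grid_pmf m)) {y. P (override_on \<eta> y J)}"
    using J set_Pi_pmf[OF J, of undefined "\<lambda>_. grid_pmf m"]
    by (intro measure_prob_cong_0) (auto simp: Y_def o_def set_pmf_eq)
  also have "\<dots> = measure_pmf.prob (resample (grid_pmf m) \<eta> J) {\<omega>. P \<omega>}"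
    by (simp add: resample_def vimage_def)
  finally show "measure ?M E = measure_pmf.prob (resample (grid_pmf m) \<eta> J) {\<omega>. P \<omega>}" .
qed

lemma mis_coins_grid:
  assumes "mis_graph G \<Delta> k"
  shows "mis_coins G \<Delta> T k (grid_pmf (T + 1))"
proof -
  interpret mis_graph G \<Delta> T k using assms .
  show ?thesis using prob_grid_pmf finite_grid_pmf by unfold_locales auto
qed

context mis_graph
begin

text \<open>\<open>glue\<close> is prescribed only at the coins that a run reads. This admits both
  the identity, for \<open>N = verts G\<close>, and the merge of random inner coins with fixed outer
  ones.\<close>

lemma run_discretise:
  fixes \<eta> :: "'a \<times> coin \<Rightarrow> real" and P :: "'a state \<Rightarrow> bool"
  assumes N: "finite N"
    and glue: "\<And>\<omega> u c. u \<in> verts G \<Longrightarrow> c \<in> coins T k \<Longrightarrow> glue \<omega> (u, c) = (if u \<in> N then \<omega> (u, c) else \<eta> (u, c))"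
  defines "J \<equiv> N \<times> coins T k"
  defines "E \<equiv> {\<omega> \<in> space (PiM J (\<lambda>_. unif)). P (state_after G \<Delta> T k (glue \<omega>) T)}"
  shows "E \<in> sets (PiM J (\<lambda>_. unif))"
    and "measure (PiM J (\<lambda>_. unif)) E =
      measure_pmf.prob (resample (grid_pmf (T + 1)) \<eta> J) {\<omega>. P (state_after G \<Delta> T k \<omega> T)}"
proof -
  interpret C: mis_coins G \<Delta> T k "grid_pmf (T + 1)"
    by (intro mis_coins_grid mis_graph_axioms)
  have J: "finite J" unfolding J_def using N finite_coin_set by (rule finite_cartesian_product)
  have "state_after G \<Delta> T k (glue \<omega>) T = state_after G \<Delta> T k (override_on \<eta> (to_grid (T + 1) \<circ> \<omega>) J) T" for \<omega>
  proof (rule C.run_cong[OF order_refl])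
    fix u t i j assume "u \<in> verts G" "t \<in> {1..T}" "i < k" "j \<in> {1..T + 1}"
    moreover from this have "Sample t i \<in> coins T k" by (auto simp: coins_def)
    ultimately show "glue \<omega> (u, Sample t i) < (1 / 2) ^ j \<longleftrightarrow>
        override_on \<eta> (to_grid (T + 1) \<circ> \<omega>) J (u, Sample t i) < (1 / 2) ^ j"
      using to_grid_less_iff[of j "T + 1"] by (simp add: glue override_on_def J_def)
  next
    fix u t j assume "u \<in> verts G" "t \<in> {1..T}" "j \<in> {1..T + 1}"
    moreover from this have "Mark t \<in> coins T k" by (auto simp: coins_def)
    ultimately show "glue \<omega> (u, Mark t) < (1 / 2) ^ j \<longleftrightarrow>
        override_on \<eta> (to_grid (T + 1) \<circ> \<omega>) J (u, Mark t) < (1 / 2) ^ j"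
      using to_grid_less_iff[of j "T + 1"] by (simp add: glue override_on_def J_def)
  qed
  then show "E \<in> sets (PiM J (\<lambda>_. unif))" "measure (PiM J (\<lambda>_. unif)) E =
      measure_pmf.prob (resample (grid_pmf (T + 1)) \<eta> J) {\<omega>. P (state_after G \<Delta> T k \<omega> T)}"
    using discretise[OF J, where P = "\<lambda>\<omega>. P (state_after G \<Delta> T k \<omega> T)" and m = "T + 1" and \<eta> = \<eta>]
    by (simp_all add: E_def)
qed

end

section \<open>Separated sets in a connected set of nodes\<close>

context mis_graph
begin

text \<open>Adjacency made reflexive, so that its \<open>r\<close>-th power relates nodes at
  distance at most \<open>r\<close> and \<open>near r v\<close> is a ball.\<close>

definition hop :: "('a \<times> 'a) set" where
  "hop = {(u, v). v \<in> insert u (nbrs G u)}"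

abbreviation near :: "nat \<Rightarrow> 'a \<Rightarrow> 'a set" where "near r v \<equiv> (hop ^^ r) `` {v}"

lemma near_sym: "u \<in> near r v \<longleftrightarrow> v \<in> near r u"
proof -
  have "v \<in> near r u" if "u \<in> near r v" for u v
    using that
  proof (induction r arbitrary: u)
    case (Suc r)
    then obtain y where y: "(v, y) \<in> hop ^^ r" "(y, u) \<in> hop" by auto
    then have "(y, v) \<in> hop ^^ r" "(u, y) \<in> hop" using Suc.IH[of y] nbrs_sym by (auto simp: hop_def)
    then show ?case using relpow_Suc_I2 by fast
  qed simp
  then show ?thesis by blast
qed

lemma near_trans: "v \<in> near a u \<Longrightarrow> w \<in> near b v \<Longrightarrow> w \<in> near (a + b) u"
  by (auto simp: relpow_add)

lemma near_mono: "a \<le> b \<Longrightarrow> near a v \<subseteq> near b v"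
proof -
  assume "a \<le> b"
  moreover have "(x, x) \<in> hop ^^ n" for x n
    by (induction n) (auto simp: hop_def intro: relcompI)
  ultimately show ?thesis using near_trans[of _ a v _ "b - a"] by auto
qed

lemma card_near: "finite (near r v) \<and> card (near r v) \<le> (\<Delta> + 1) ^ r"
proof (induction r)
  case (Suc r)
  have eq: "near (Suc r) v = (\<Union>u\<in>near r v. insert u (nbrs G u))"
    by (auto simp: hop_def)
  have "card (near (Suc r) v) \<le> (\<Sum>u\<in>near r v. card (insert u (nbrs G u)))"
    unfolding eq using Suc by (intro card_UN_le) simp
  also have "\<dots> \<le> (\<Sum>u\<in>near r v. \<Delta> + 1)"
    using card_nbrs by (intro sum_mono) (auto simp: card_insert_if intro: le_SucI)
  also have "\<dots> = card (near r v) * (\<Delta> + 1)" by simp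
  also have "\<dots> \<le> (\<Delta> + 1) ^ r * (\<Delta> + 1)" using Suc by (intro mult_right_mono) auto
  also have "\<dots> = (\<Delta> + 1) ^ Suc r" by simp
  finally show ?case using Suc unfolding eq by auto
qed simp

lemma two_hop_near: "two_hop G v \<subseteq> near 2 v"
  by (auto simp: two_hop_def hop_def numeral_2_eq_2 relcomp_unfold)

lemma disjoint_two_hop:
  assumes "\<And>u v. u \<in> S \<Longrightarrow> v \<in> S \<Longrightarrow> u \<noteq> v \<Longrightarrow> v \<notin> near 4 u"
  shows "disjoint_family_on (two_hop G) S"
proof (unfold disjoint_family_on_def, intro ballI impI)
  fix u v assume uv: "u \<in> S" "v \<in> S" "u \<noteq> v"
  show "two_hop G u \<inter> two_hop G v = {}"
  proof (rule ccontr)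
    assume "\<not> ?thesis"
    then obtain w where "w \<in> near 2 u" "w \<in> near 2 v" using two_hop_near by blast
    then have "v \<in> near (2 + 2) u" using near_sym[of w 2 v] by (intro near_trans[of w 2 u v 2]) auto
    then show False using assms[OF uv] by simp
  qed
qed

text \<open>The walk reaches a new node by a detour of two steps, so that walks of length \<open>2 * s\<close> can be
  counted instead of connected sets.\<close>

lemma separated_walk:
  assumes U: "finite U" "U \<noteq> {}"
    and conn: "\<And>X. X \<subset> U \<Longrightarrow> X \<noteq> {} \<Longrightarrow> \<exists>y\<in>X. \<exists>z\<in>U - X. z \<in> nbrs G y"
    and card: "s * (\<Delta> + 1) ^ 4 < card U"
  shows "\<exists>w. length w = 2 * s + 1 \<and> set w \<subseteq> U \<and> card (set w) = s + 1 \<and>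
    successively (\<lambda>u v. v \<in> near 5 u) w \<and> (\<forall>u\<in>set w. \<forall>v\<in>set w. u \<noteq> v \<longrightarrow> v \<notin> near 4 u)"
  using card
proof (induction s)
  case 0
  obtain u where "u \<in> U" using U by blast
  then show ?case by (intro exI[of _ "[u]"]) auto
next
  case (Suc s)
  then obtain w where w: "length w = 2 * s + 1" "set w \<subseteq> U" "card (set w) = s + 1"
    "successively (\<lambda>u v. v \<in> near 5 u) w" "\<And>u v. u \<in> set w \<Longrightarrow> v \<in> set w \<Longrightarrow> u \<noteq> v \<Longrightarrow> v \<notin> near 4 u"
    by auto
  \<comment> \<open>The balls of radius 4 around the walk are too small to exhaust \<open>U\<close>,
    so an edge of the graph leaves \<open>X\<close> inside \<open>U\<close>. Its end
    \<open>z\<close> lies outside all these balls but within distance 5 of some \<open>x\<close> on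
    the walk.\<close>
  define X where "X = U \<inter> (\<Union>u\<in>set w. near 4 u)"
  have "card (\<Union>u\<in>set w. near 4 u) \<le> (\<Sum>u\<in>set w. card (near 4 u))" by (intro card_UN_le) simp
  also have "\<dots> \<le> (\<Sum>u\<in>set w. (\<Delta> + 1) ^ 4)" using card_near by (intro sum_mono) blast
  also have "\<dots> < card U" using Suc.prems w(3) by simp
  finally have "\<not> U \<subseteq> (\<Union>u\<in>set w. near 4 u)"
    using card_mono[of "\<Union>u\<in>set w. near 4 u" U] card_near by auto
  then have "X \<subset> U" by (auto simp: X_def)
  moreover have "set w \<subseteq> X" using w(2) near_mono[of 0 4] by (auto simp: X_def)
  then have "X \<noteq> {}" using w(3) by (metis Suc_eq_plus1 card.empty nat.distinct(1) subset_empty)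
  ultimately obtain y z where yz: "y \<in> X" "z \<in> U - X" "z \<in> nbrs G y" using conn by blast
  obtain x where x: "x \<in> set w" "y \<in> near 4 x" using yz(1) by (auto simp: X_def)
  have "z \<in> near 1 y" using yz(3) by (auto simp: hop_def)
  then have "z \<in> near (4 + 1) x" by (rule near_trans[OF x(2)])
  then have xz: "z \<in> near 5 x" "x \<in> near 5 z" using near_sym[of z 5 x] by auto
  have far: "z \<notin> near 4 u" "u \<notin> near 4 z" if "u \<in> set w" for u
    using yz(2) that near_sym[of z 4 u] by (auto simp: X_def)
  have "z \<notin> set w" using yz(2) \<open>set w \<subseteq> X\<close> by blast
  obtain a b where ab: "w = a @ x # b" using x(1) by (auto simp: in_set_conv_decomp)
  show ?case
  proof (intro exI[of _ "a @ x # z # x # b"] conjI ballI impI)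
    have set: "set (a @ x # z # x # b) = insert z (set w)" by (auto simp: ab)
    show "card (set (a @ x # z # x # b)) = Suc s + 1" unfolding set using \<open>z \<notin> set w\<close> w(3) by simp
    show "set (a @ x # z # x # b) \<subseteq> U" unfolding set using w(2) yz(2) by blast
    show "length (a @ x # z # x # b) = 2 * Suc s + 1" using w(1) by (simp add: ab)
    show "successively (\<lambda>u v. v \<in> near 5 u) (a @ x # z # x # b)"
      using w(4) xz by (auto simp: ab successively_append_iff successively_Cons)
    show "v \<notin> near 4 u" if "u \<in> set (a @ x # z # x # b)" "v \<in> set (a @ x # z # x # b)" "u \<noteq> v" for u v
      using that w(5) far unfolding set by auto
  qed
qed

text \<open>A walk is extended at its front by a node near its head; symmetry of \<open>near\<close>
  bounds the choices by the size of a ball.\<close>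

lemma card_walks:
  "finite {w. length w = l + 1 \<and> set w \<subseteq> verts G \<and> successively (\<lambda>u v. v \<in> near r u) w} \<and>
   card {w. length w = l + 1 \<and> set w \<subseteq> verts G \<and> successively (\<lambda>u v. v \<in> near r u) w}
     \<le> card (verts G) * ((\<Delta> + 1) ^ r) ^ l"
proof (induction l)
  case 0
  have "{w. length w = 0 + 1 \<and> set w \<subseteq> verts G \<and> successively (\<lambda>u v. v \<in> near r u) w} = (\<lambda>v. [v]) ` verts G"
    by (auto simp: length_Suc_conv)
  then show ?case by (simp add: card_image inj_on_def)
next
  case (Suc l)
  define W where "W l = {w. length w = l + 1 \<and> set w \<subseteq> verts G \<and> successively (\<lambda>u v. v \<in> near r u) w}" for l
  have IH: "finite (W l)" "card (W l) \<le> card (verts G) * ((\<Delta> + 1) ^ r) ^ l"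
    using Suc.IH by (simp_all add: W_def)
  have sub: "W (Suc l) \<subseteq> (\<Union>w\<in>W l. (\<lambda>v. v # w) ` near r (hd w))"
  proof
    fix w assume "w \<in> W (Suc l)"
    then obtain v w' where "w = v # w'" "w' \<in> W l" "hd w' \<in> near r v"
      by (auto simp: W_def length_Suc_conv)
    then show "w \<in> (\<Union>w\<in>W l. (\<lambda>v. v # w) ` near r (hd w))" using near_sym[of "hd w'" r v] by auto
  qed
  have fin: "finite (\<Union>w\<in>W l. (\<lambda>v. v # w) ` near r (hd w))" using IH(1) card_near by blast
  have "card (W (Suc l)) \<le> card (\<Union>w\<in>W l. (\<lambda>v. v # w) ` near r (hd w))" by (rule card_mono[OF fin sub])
  also have "\<dots> \<le> (\<Sum>w\<in>W l. card ((\<lambda>v. v # w) ` near r (hd w)))" using IH(1) by (rule card_UN_le)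
  also have "\<dots> \<le> (\<Sum>w\<in>W l. (\<Delta> + 1) ^ r)"
  proof (rule sum_mono)
    fix w
    show "card ((\<lambda>v. v # w) ` near r (hd w)) \<le> (\<Delta> + 1) ^ r"
      using card_near[of r "hd w"] card_image_le[of "near r (hd w)" "\<lambda>v. v # w"] by linarith
  qed
  also have "\<dots> \<le> card (verts G) * ((\<Delta> + 1) ^ r) ^ Suc l" using mult_right_mono[OF IH(2), of "(\<Delta> + 1) ^ r"]
    by (simp add: mult_ac)
  finally show ?case using finite_subset[OF sub fin] by (simp add: W_def)
qed

text \<open>Connectedness is put into the form used to grow a walk: an edge leaves every proper
  nonempty part. It is defined through the symmetric closure of \<open>H\<close>, whose arcs are
  traced back to \<open>G\<close> in \<open>edge\<close>.\<close>

lemma component_connected: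
  assumes H: "graph_component (G \<restriction> B) H" and B: "B \<subseteq> verts G"
  shows "verts H \<subseteq> B" and "verts H \<noteq> {}"
    and "X \<subset> verts H \<Longrightarrow> X \<noteq> {} \<Longrightarrow> \<exists>y\<in>X. \<exists>z\<in>verts H - X. z \<in> nbrs G y"
proof -
  have sub: "subgraph H (G \<restriction> B)" and conn: "Digraph_Component.connected H"
    using H by (auto simp: graph_component_def pre_digraph.max_subgraph_def)
  show "verts H \<subseteq> B" using sub by (auto simp: subgraph_def)
  show "verts H \<noteq> {}" using conn by (auto simp: connected_def strongly_connected_def)
  have edge: "v \<in> nbrs G u" if "(u, v) \<in> arcs_ends (with_proj (mk_symmetric H))" for u v
  proof -
    have "(u, v) \<in> parcs (mk_symmetric H)" using that by simp
    then obtain e where "e \<in> arcs H" "(u, v) = (tail H e, head H e) \<or> (u, v) = (head H e, tail H e)"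
      unfolding parcs_mk_symmetric by blast
    moreover have "e \<in> arcs G" "tail H e = tail G e" "head H e = head G e"
      using sub \<open>e \<in> arcs H\<close> by (auto simp: subgraph_def compatible_def induce_subgraph_def)
    ultimately have "v \<in> nbrs G u \<or> u \<in> nbrs G v"
      by (auto simp: nbrs_def arcs_ends_def arc_to_ends_def)
    then show ?thesis using nbrs_sym by blast
  qed
  show "\<exists>y\<in>X. \<exists>z\<in>verts H - X. z \<in> nbrs G y" if X: "X \<subset> verts H" "X \<noteq> {}"
  proof (rule ccontr)
    assume no: "\<not> ?thesis"
    obtain x z where xz: "x \<in> X" "z \<in> verts H - X" using X by blast
    have "(x, z) \<in> rtrancl_on (verts H) (arcs_ends (with_proj (mk_symmetric H)))"
      using conn xz X by (auto simp: connected_def strongly_connected_def reachable_def)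
    then have "z \<in> X"
      using xz(1)
    proof (induction rule: rtrancl_on_induct)
      case (step y z)
      then show ?case using no edge by blast
    qed
    then show False using xz by blast
  qed
qed

end

section \<open>Parameters\<close>

lemma parameters:
  obtains \<beta> c0 C0 :: real where "1 < \<beta>" "\<beta> powr 8 * (1 - exp (- 60) / 2560) \<le> 1" "0 < c0" "0 < C0"
    and "\<And>c C \<Delta>. c0 \<le> c \<Longrightarrow> C0 \<le> C \<Longrightarrow> 3 \<le> \<Delta> \<Longrightarrow> 0 < num_reps C \<Delta> \<and>
      (1 / \<beta> + real (\<Delta> + 1) * (1 / 4) ^ num_reps C \<Delta> * \<beta> powr (7 + log 2 \<Delta>)) ^ num_iters c \<Delta>
        * \<beta> powr (30 + 6 * log 2 \<Delta>) \<le> 1 / real \<Delta> ^ 98"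
proof -
  define g :: real where "g = exp (- 60) / 2560"
  have g: "0 < g" by (simp add: g_def)
  have "exp (- 60) < (1::real)" by simp
  then have "g < 1 / 2" unfolding g_def by linarith
  note g = g this
  \<comment> \<open>The largest base for which a golden iteration still contracts:
    \<open>\<beta> powr 8 * (1 - g) = 1\<close>.\<close>
  define \<beta> where "\<beta> = (1 - g) powr (- 1 / 8)"
  have "\<beta> powr 8 = (1 - g) powr (- 1 / 8 * 8)" unfolding \<beta>_def by (rule powr_powr)
  also have "\<dots> = 1 / (1 - g)" using g by (simp add: powr_minus_divide)
  finally have \<beta>_eq: "\<beta> powr 8 = 1 / (1 - g)" .
  then have \<beta>8: "\<beta> powr 8 * (1 - g) \<le> 1" using g by simp
  have "(1 - g) powr (1 / 8) < 1 powr (1 / 8)" using g by (intro powr_less_mono2) auto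
  then have \<beta>: "1 < \<beta>" using g by (simp add: \<beta>_def powr_minus_divide less_divide_eq)
  have "\<beta> powr 1 \<le> 1 / (1 - g)" unfolding \<beta>_eq[symmetric] using \<beta> by (intro powr_mono) auto
  also have "1 / (1 - g) \<le> 2" using g by (simp add: field_simps)
  finally have \<beta>2: "\<beta> \<le> 2" using \<beta> by simp
  \<comment> \<open>Half of the gap between \<open>1 / \<beta>\<close> and 1 is granted to the
    inaccurate estimates.\<close>
  define \<delta> where "\<delta> = (1 - 1 / \<beta>) / 2"
  define \<theta> where "\<theta> = 1 / \<beta> + \<delta>"
  have \<delta>: "0 < \<delta>" using \<beta> by (simp add: \<delta>_def)
  have \<theta>: "0 < \<theta>" "\<theta> < 1" using \<beta> by (auto simp: \<theta>_def \<delta>_def field_simps)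
  \<comment> \<open>\<open>134 = 98 + 36\<close>: the target exponent, and 36 for the initial
    potential, since \<open>30 + 6 * l \<le> 36 * l\<close> for
    \<open>l = log 2 \<Delta> \<ge> 1\<close>.\<close>
  define c0 where "c0 = 134 / log 2 (1 / \<theta>)"
  \<comment> \<open>The inaccuracy term is at most \<open>2 powr (7 + 3 * l - 24 * C * l)\<close>,
    hence at most \<open>2 powr (10 - 24 * C)\<close> as \<open>l \<ge> 1\<close> and
    \<open>C \<ge> 1\<close>; this choice brings it below \<open>\<delta>\<close>.\<close>
  define C0 where "C0 = max 1 ((10 + log 2 (1 / \<delta>)) / 24)"
  have "0 < log 2 (1 / \<theta>)" using \<theta> by simp
  then have c0: "0 < c0" "\<theta> powr c0 = 2 powr (- 134)"
  proof -
    show "0 < c0" using \<open>0 < log 2 (1 / \<theta>)\<close> by (simp add: c0_def)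
    have "\<theta> = 2 powr (- log 2 (1 / \<theta>))" using \<theta> by (simp add: log_divide powr_minus_divide)
    then have "\<theta> powr c0 = 2 powr (- log 2 (1 / \<theta>) * c0)" by (metis powr_powr)
    then show "\<theta> powr c0 = 2 powr (- 134)" using \<open>0 < log 2 (1 / \<theta>)\<close> by (simp add: c0_def)
  qed
  have C0: "1 \<le> C0" "10 - 24 * C0 \<le> log 2 \<delta>" using \<delta> by (auto simp: C0_def log_divide max_def field_simps)
  have main: "0 < num_reps C \<Delta> \<and>
      (1 / \<beta> + real (\<Delta> + 1) * (1 / 4) ^ num_reps C \<Delta> * \<beta> powr (7 + log 2 \<Delta>)) ^ num_iters c \<Delta>
        * \<beta> powr (30 + 6 * log 2 \<Delta>) \<le> 1 / real \<Delta> ^ 98"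
    if c: "c0 \<le> c" and C: "C0 \<le> C" and \<Delta>: "3 \<le> \<Delta>" for c C and \<Delta> :: nat
  proof
    define l where "l = log 2 (real \<Delta>)"
    define k where "k = num_reps C \<Delta>"
    define T where "T = num_iters c \<Delta>"
    have l: "1 \<le> l" "2 powr l = \<Delta>" using \<Delta> by (auto simp: l_def le_log_iff)
    have k: "12 * C * l \<le> k" unfolding k_def num_reps_def l_def by linarith
    have T: "c * l \<le> T" unfolding T_def num_iters_def l_def by linarith
    have "1 * 1 \<le> C * l" using C C0 l by (intro mult_mono) auto
    then show "0 < num_reps C \<Delta>" using k unfolding k_def by linarith
    have "(1 / 4) ^ k = (2::real) powr (- 2 * real k)"
    proof -
      have "(2::real) powr (- 2 * real k) = (2 powr (- 2)) powr real k" by (simp add: powr_powr)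
      also have "\<dots> = (1 / 4) ^ k" by (simp add: powr_realpow powr_minus_divide)
      finally show ?thesis ..
    qed
    also have "\<dots> \<le> 2 powr (- 24 * C * l)" using k by (intro powr_mono) auto
    finally have k4: "(1 / 4) ^ k \<le> (2::real) powr (- 24 * C * l)" .
    have "real (\<Delta> + 1) * (1 / 4) ^ k * \<beta> powr (7 + l) \<le> 2 powr (2 * l) * 2 powr (- 24 * C * l) * 2 powr (7 + l)"
    proof (intro mult_mono k4)
      have "3 * real \<Delta> \<le> real \<Delta> * real \<Delta>" using \<Delta> by (intro mult_right_mono) auto
      then have "real (\<Delta> + 1) \<le> real \<Delta> * real \<Delta>" using \<Delta> by linarith
      also have "\<dots> = 2 powr (2 * l)" unfolding mult_2 powr_add l(2) ..
      finally show "real (\<Delta> + 1) \<le> 2 powr (2 * l)" .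
      show "\<beta> powr (7 + l) \<le> 2 powr (7 + l)" using \<beta> \<beta>2 l by (intro powr_mono2) auto
    qed auto
    also have "\<dots> = 2 powr (7 + 3 * l - 24 * C * l)"
    proof -
      have "2 * l + - 24 * C * l + (7 + l) = 7 + 3 * l - 24 * C * l" by simp
      then show ?thesis by (simp only: powr_add[symmetric])
    qed
    also have "\<dots> \<le> 2 powr (log 2 \<delta>)"
    proof (rule powr_mono)
      have "(3 - 24 * C) * l \<le> (3 - 24 * C) * 1" using C C0 l by (intro mult_left_mono_neg) auto
      then show "7 + 3 * l - 24 * C * l \<le> log 2 \<delta>" using C C0 by (simp add: algebra_simps)
    qed simp
    also have "\<dots> = \<delta>" using \<delta> by simp
    finally have contr: "1 / \<beta> + real (\<Delta> + 1) * (1 / 4) ^ k * \<beta> powr (7 + l) \<le> \<theta>" by (simp add: \<theta>_def)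
    have "(1 / \<beta> + real (\<Delta> + 1) * (1 / 4) ^ k * \<beta> powr (7 + l)) ^ T \<le> \<theta> ^ T"
      using contr \<beta> by (intro power_mono) auto
    also have "\<dots> = \<theta> powr T" using \<theta> by (simp add: powr_realpow)
    also have "\<dots> \<le> \<theta> powr (c0 * l)"
    proof (rule powr_mono')
      have "c0 * l \<le> c * l" using c l by (intro mult_right_mono) auto
      then show "c0 * l \<le> T" using T by simp
    qed (use \<theta> in auto)
    also have "\<dots> = 2 powr (- 134 * l)" by (simp flip: powr_powr add: c0(2)) (simp add: powr_powr)
    finally have 1: "(1 / \<beta> + real (\<Delta> + 1) * (1 / 4) ^ k * \<beta> powr (7 + l)) ^ T \<le> 2 powr (- 134 * l)" .
    have "\<beta> powr (30 + 6 * l) \<le> 2 powr (30 + 6 * l)" using \<beta> \<beta>2 l by (intro powr_mono2) auto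
    also have "\<dots> \<le> 2 powr (36 * l)" using l by (intro powr_mono) auto
    finally have 2: "\<beta> powr (30 + 6 * l) \<le> 2 powr (36 * l)" .
    have "(1 / \<beta> + real (\<Delta> + 1) * (1 / 4) ^ k * \<beta> powr (7 + l)) ^ T * \<beta> powr (30 + 6 * l)
        \<le> 2 powr (- 134 * l) * 2 powr (36 * l)"
      using 1 2 by (intro mult_mono) auto
    also have "\<dots> = 2 powr (l * (- 98))"
    proof -
      have "- 134 * l + 36 * l = l * (- 98)" by simp
      then show ?thesis by (simp only: powr_add[symmetric])
    qed
    also have "\<dots> = 1 / real \<Delta> ^ 98" unfolding powr_powr[symmetric] l(2) using \<Delta> by (simp add: powr_minus_divide)
    finally show "(1 / \<beta> + real (\<Delta> + 1) * (1 / 4) ^ num_reps C \<Delta> * \<beta> powr (7 + log 2 \<Delta>)) ^ num_iters c \<Delta>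
        * \<beta> powr (30 + 6 * log 2 \<Delta>) \<le> 1 / real \<Delta> ^ 98"
      unfolding l_def k_def T_def .
  qed
  have "0 < C0" using C0(1) by simp
  from that[OF \<beta> \<beta>8[unfolded g_def] c0(1) this main] show ?thesis .
qed

section \<open>Uncovered nodes and components\<close>

lemma prob_space_randomness: "prob_space (randomness N C c \<Delta>)"
  unfolding randomness_def by (intro prob_space_PiM prob_space_unif)

lemma (in mis_coins) not_covered_remaining:
  assumes "t \<le> T" "v \<in> verts G" "\<forall>u\<in>insert v (nbrs G v). u \<notin> indep_set (run \<omega> t)"
  shows "v \<in> remaining (run \<omega> t)"
  using assms
proof (induction t)
  case (Suc t)
  interpret mis_round_coins G \<Delta> T k "Suc t" "run \<omega> t" q
    using Suc.prems by (intro round_coins) simp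
  have run: "run \<omega> (Suc t) = iteration G \<Delta> T k \<omega> (Suc t) (run \<omega> t)" by simp
  have "v \<in> remaining (run \<omega> t)" using Suc unfolding run iteration_eq by simp
  then show ?case using Suc.prems(3) nbrs_sym unfolding run iteration_eq by auto
qed simp

context
  fixes c C :: real and G :: "('a, 'b) pre_digraph"
  assumes G: "graph G" "3 \<le> max_degree G"
    and k: "0 < num_reps C (max_degree G)"
begin

abbreviation (input) Delta where "Delta \<equiv> max_degree G"

lemma mis_graph_max_degree: "mis_graph G Delta (num_reps C Delta)"
proof -
  interpret graph G by (rule G)
  have "card (nbrs G v) \<le> Delta" for v
  proof (cases "v \<in> verts G")
    case True
    have "nbrs G v = head G ` out_arcs G v"
      by (auto simp: nbrs_def arcs_ends_def arc_to_ends_def out_arcs_def image_iff)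
    then have "card (nbrs G v) \<le> out_degree G v"
      unfolding out_degree_def by (simp add: card_image_le out_arcs_def)
    also have "\<dots> \<le> Delta" unfolding max_degree_def using True by (intro Max_ge) auto
    finally show ?thesis .
  next
    case False
    then have "nbrs G v = {}" by (auto simp: nbrs_def)
    then show ?thesis by simp
  qed
  then show ?thesis using G(2) k by unfold_locales auto
qed

interpretation mis_graph G Delta "num_iters c Delta" "num_reps C Delta"
  by (rule mis_graph_max_degree)

interpretation C: mis_coins G Delta "num_iters c Delta" "num_reps C Delta" "grid_pmf (num_iters c Delta + 1)"
  by (intro mis_coins_grid mis_graph_max_degree)

text \<open>Makes the logarithm of the number of nodes positive, so that the union bound over
  separated sets deals with at least one node.\<close>

lemma card_verts_ge:
  assumes "verts G \<noteq> {}"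
  shows "2 \<le> card (verts G)"
proof -
  have "Delta \<in> out_degree G ` verts G"
    unfolding max_degree_def using assms by (intro Max_in) auto
  then obtain v where v: "v \<in> verts G" "out_degree G v = Delta" by auto
  then have "out_arcs G v \<noteq> {}" using G(2) by (auto simp: out_degree_def)
  then obtain e where "e \<in> arcs G" "tail G e = v" by (auto simp: out_arcs_def)
  then have u: "head G e \<in> nbrs G v" by (auto simp: nbrs_def arcs_ends_def arc_to_ends_def)
  define u where "u = head G e"
  have "u \<noteq> v" using u not_self_nbr[of v] by (auto simp: u_def)
  then have "card {u, v} = 2" "{u, v} \<subseteq> verts G"
    using v u nbrs_subset by (auto simp: u_def)
  then show ?thesis using card_mono[of "verts G" "{u, v}"] by simp
qed

context
  fixes N :: "'a set" and glue :: "('a \<times> coin \<Rightarrow> real) \<Rightarrow> 'a \<times> coin \<Rightarrow> real" and \<eta> :: "'a \<times> coin \<Rightarrow> real"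
  assumes N: "N \<subseteq> verts G"
    and glue: "\<And>\<omega> u x. u \<in> verts G \<Longrightarrow> x \<in> coins (num_iters c Delta) (num_reps C Delta) \<Longrightarrow>
      glue \<omega> (u, x) = (if u \<in> N then \<omega> (u, x) else \<eta> (u, x))"
begin

lemma finite_N: "finite N"
  by (rule finite_subset[OF N finite_verts])

lemma event_measurable:
  "{\<omega> \<in> space (randomness N C c Delta). P (final_state G C c (glue \<omega>))} \<in> sets (randomness N C c Delta)"
  using run_discretise(1)[where N = N and glue = glue and \<eta> = \<eta>, OF finite_N glue]
  by (simp add: randomness_def node_coins_def final_state_def Let_def)

context
  fixes \<beta> :: real
  assumes \<beta>: "1 < \<beta>" "\<beta> powr 8 * (1 - exp (- 60) / 2560) \<le> 1"
    and bound: "(1 / \<beta> + real (Delta + 1) * (1 / 4) ^ num_reps C Delta * \<beta> powr (7 + log 2 Delta)) ^ num_iters c Delta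
        * \<beta> powr (30 + 6 * log 2 Delta) \<le> 1 / real Delta ^ 98"
begin

text \<open>Serves both claims: with a singleton \<open>S\<close> for covering, and with the node
  set of a separated walk for the components.\<close>

lemma remaining_prob:
  assumes "disjoint_family_on (two_hop G) S" "S \<subseteq> verts G" "\<And>v. v \<in> S \<Longrightarrow> two_hop G v \<subseteq> N"
  shows "measure (randomness N C c Delta)
      {\<omega> \<in> space (randomness N C c Delta). S \<subseteq> remaining (final_state G C c (glue \<omega>))}
    \<le> (1 / real Delta ^ 98) ^ card S"
proof -
  have "finite S" by (rule finite_subset[OF assms(2) finite_verts])
  have "measure (randomness N C c Delta)
      {\<omega> \<in> space (randomness N C c Delta). S \<subseteq> remaining (final_state G C c (glue \<omega>))}
    = measure_pmf.prob (resample (grid_pmf (num_iters c Delta + 1)) \<eta> (N \<times> coins (num_iters c Delta) (num_reps C Delta)))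
      {\<omega>. S \<subseteq> remaining (C.run \<omega> (num_iters c Delta))}"
    using run_discretise(2)[where N = N and glue = glue and \<eta> = \<eta>, OF finite_N glue, where P = "\<lambda>s. S \<subseteq> remaining s"]
    by (simp add: randomness_def node_coins_def final_state_def Let_def)
  also have "\<dots> \<le> (C.contraction \<beta> ^ num_iters c Delta * \<beta> powr (30 + 6 * log 2 Delta)) ^ card S"
    by (rule C.survival_prob[OF \<beta> \<open>finite S\<close> assms(1,3) finite_N])
  also have "\<dots> \<le> (1 / real Delta ^ 98) ^ card S"
    using bound \<beta> by (intro power_mono) (auto simp: C.contraction_def)
  finally show ?thesis .
qed

lemma covered_prob:
  assumes v: "v \<in> verts G" "two_hop G v \<subseteq> N"
  shows "measure (randomness N C c Delta) {\<omega> \<in> space (randomness N C c Delta). covered G C c v (glue \<omega>)}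
    \<ge> 1 - 1 / real Delta ^ 98"
proof -
  let ?M = "randomness N C c Delta"
  interpret prob_space ?M by (rule prob_space_randomness)
  let ?A = "{\<omega> \<in> space ?M. covered G C c v (glue \<omega>)}"
  have A: "?A \<in> sets ?M" unfolding covered_def by (rule event_measurable)
  have "prob (space ?M - ?A) \<le> prob {\<omega> \<in> space ?M. {v} \<subseteq> remaining (final_state G C c (glue \<omega>))}"
  proof (intro finite_measure_mono event_measurable subsetI)
    fix \<omega> assume "\<omega> \<in> space ?M - ?A"
    then show "\<omega> \<in> {\<omega> \<in> space ?M. {v} \<subseteq> remaining (final_state G C c (glue \<omega>))}"
      using C.not_covered_remaining[OF order_refl v(1), of "glue \<omega>"]
      by (auto simp: covered_def final_state_def Let_def)
  qed
  also have "\<dots> \<le> (1 / real Delta ^ 98) ^ card {v}"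
    using v by (intro remaining_prob) (auto simp: disjoint_family_on_def)
  finally show ?thesis using prob_compl[OF A] by simp
qed

end

end

section \<open>Union bound over separated walks\<close>

lemma small_components_prob:
  fixes a \<beta> :: real
  assumes \<beta>: "1 < \<beta>" "\<beta> powr 8 * (1 - exp (- 60) / 2560) \<le> 1"
    and bound: "(1 / \<beta> + real (Delta + 1) * (1 / 4) ^ num_reps C Delta * \<beta> powr (7 + log 2 Delta)) ^ num_iters c Delta
        * \<beta> powr (30 + 6 * log 2 Delta) \<le> 1 / real Delta ^ 98"
    and a: "0 < a"
  shows "measure (randomness (verts G) C c Delta) {\<omega> \<in> space (randomness (verts G) C c Delta).
      \<forall>H. graph_component (G \<restriction> remaining (final_state G C c \<omega>)) H \<longrightarrow>
        real (card (verts H)) \<le> 4 * (a + 1) * (log (real Delta) (real (card (verts G))) * real Delta ^ 4)}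
    \<ge> 1 - 1 / real (card (verts G)) powr a"
proof -
  let ?M = "randomness (verts G) C c Delta"
  define n where "n = card (verts G)"
  define bnd where "bnd = 4 * (a + 1) * (log (real Delta) (real n) * real Delta ^ 4)"
  define rem where "rem \<omega> = remaining (final_state G C c \<omega>)" for \<omega>
  define small where "small B \<longleftrightarrow> (\<forall>H. graph_component (G \<restriction> B) H \<longrightarrow> real (card (verts H)) \<le> bnd)" for B
  interpret prob_space ?M by (rule prob_space_randomness)
  have measurable: "{\<omega> \<in> space ?M. P (final_state G C c \<omega>)} \<in> sets ?M" for P
    by (rule event_measurable[where glue = "\<lambda>\<omega>. \<omega>" and \<eta> = "\<lambda>_. 0"]) auto
  have rem_sub: "rem \<omega> \<subseteq> verts G" for \<omega>
    using C.run_invariant[OF order_refl] by (simp add: rem_def final_state_def Let_def)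
  let ?A = "{\<omega> \<in> space ?M. small (rem \<omega>)}"
  have A: "?A \<in> sets ?M" unfolding rem_def by (rule measurable)
  have "prob (space ?M - ?A) \<le> 1 / real n powr a"
  \<comment> \<open>For the empty graph \<open>max_degree\<close> is an unspecified
    \<open>Max {}\<close>, so the hypothesis on the degree does not exclude it.\<close>
  proof (cases "verts G = {}")
    case True
    have "small (rem \<omega>)" for \<omega>
      unfolding small_def using component_connected(1,2)[OF _ rem_sub] rem_sub True by blast
    then have "space ?M - ?A = {}" by blast
    then have "prob (space ?M - ?A) = 0" by (simp only: measure_empty)
    then show ?thesis by (simp only:) simp
  next
    case False
    then have n: "2 \<le> n" unfolding n_def by (rule card_verts_ge)
    define L where "L = log (real Delta) (real n)"
    \<comment> \<open>With this many separated nodes \<open>Delta ^ s \<ge> n powr (a + 1)\<close>: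
      one power of \<open>n\<close> pays for the starting nodes of the walks, and \<open>a\<close>
      powers remain.\<close>
    define s where "s = nat \<lceil>(a + 1) * L\<rceil>"
    have "0 < L" using n G(2) unfolding L_def by simp
    then have "0 < (a + 1) * L" using a by simp
    then have s: "1 \<le> s" "(a + 1) * L \<le> s" "real (s - 1) \<le> (a + 1) * L"
      unfolding s_def by linarith+
    define l where "l = 2 * (s - 1)"
    define W where "W = {w. length w = l + 1 \<and> set w \<subseteq> verts G \<and> successively (\<lambda>u v. v \<in> near 5 u) w}"
    define W' where "W' = {w \<in> W. card (set w) = s \<and> (\<forall>u\<in>set w. \<forall>v\<in>set w. u \<noteq> v \<longrightarrow> v \<notin> near 4 u)}"
    have W: "finite W" "card W \<le> n * ((Delta + 1) ^ 5) ^ l"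
      using card_walks[of l 5] by (simp_all add: W_def n_def)
    have W': "finite W'" "card W' \<le> card W" using W(1) by (auto simp: W'_def intro: card_mono)
    have "space ?M - ?A \<subseteq> (\<Union>w\<in>W'. {\<omega> \<in> space ?M. set w \<subseteq> rem \<omega>})"
    proof
      fix \<omega> assume \<omega>: "\<omega> \<in> space ?M - ?A"
      then obtain H where H: "graph_component (G \<restriction> rem \<omega>) H" "bnd < real (card (verts H))"
        by (auto simp: small_def not_le)
      note conn = component_connected[OF H(1) rem_sub]
      have "finite (verts H)" using conn(1) rem_sub finite_verts by (meson finite_subset)
      \<comment> \<open>Source of the factor 4 in the bound:
        \<open>(4 / 3) ^ 4 = 256 / 81 < 4\<close>.\<close>
      have "real (Delta + 1) \<le> 4 / 3 * real Delta" using G(2) by simp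
      then have "real (Delta + 1) ^ 4 \<le> (4 / 3 * real Delta) ^ 4" by (intro power_mono) auto
      also have "\<dots> = 256 / 81 * real Delta ^ 4" by (simp only: power_mult_distrib) (simp add: power_divide)
      also have "\<dots> \<le> 4 * real Delta ^ 4" by (intro mult_right_mono) auto
      finally have "real (s - 1) * real (Delta + 1) ^ 4 \<le> ((a + 1) * L) * (4 * real Delta ^ 4)"
        using s(3) by (intro mult_mono) auto
      also have "\<dots> = bnd" by (simp add: bnd_def L_def)
      also note H(2)
      finally have "real ((s - 1) * (Delta + 1) ^ 4) < real (card (verts H))" by simp
      then have "(s - 1) * (Delta + 1) ^ 4 < card (verts H)" by (simp only: of_nat_less_iff)
      from separated_walk[OF \<open>finite (verts H)\<close> conn(2,3) this]
      obtain w where w: "length w = l + 1" "set w \<subseteq> verts H" "card (set w) = s"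
        "successively (\<lambda>u v. v \<in> near 5 u) w" "\<forall>u\<in>set w. \<forall>v\<in>set w. u \<noteq> v \<longrightarrow> v \<notin> near 4 u"
        using s(1) unfolding l_def by auto
      have "set w \<subseteq> rem \<omega>" using w(2) conn(1) by blast
      moreover from this have "set w \<subseteq> verts G" using rem_sub by blast
      then have "w \<in> W'" using w by (auto simp: W'_def W_def)
      ultimately show "\<omega> \<in> (\<Union>w\<in>W'. {\<omega> \<in> space ?M. set w \<subseteq> rem \<omega>})" using \<omega> by blast
    qed
    moreover have meas: "{\<omega> \<in> space ?M. set w \<subseteq> rem \<omega>} \<in> sets ?M" for w
      unfolding rem_def by (rule measurable)
    ultimately have "prob (space ?M - ?A) \<le> prob (\<Union>w\<in>W'. {\<omega> \<in> space ?M. set w \<subseteq> rem \<omega>})"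
      using W'(1) by (intro finite_measure_mono) auto
    also have "\<dots> \<le> (\<Sum>w\<in>W'. prob {\<omega> \<in> space ?M. set w \<subseteq> rem \<omega>})"
      using W'(1) meas by (intro finite_measure_subadditive_finite) auto
    also have "\<dots> \<le> (\<Sum>w\<in>W'. (1 / real Delta ^ 98) ^ s)"
    proof (rule sum_mono)
      fix w assume w: "w \<in> W'"
      then have "disjoint_family_on (two_hop G) (set w)" by (intro disjoint_two_hop) (auto simp: W'_def)
      then have "prob {\<omega> \<in> space ?M. set w \<subseteq> rem \<omega>} \<le> (1 / real Delta ^ 98) ^ card (set w)"
        unfolding rem_def using w two_hop_subset
        by (intro remaining_prob[where glue = "\<lambda>\<omega>. \<omega>" and \<eta> = "\<lambda>_. 0" and \<beta> = \<beta>] \<beta> bound) (auto simp: W'_def W_def)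
      then show "prob {\<omega> \<in> space ?M. set w \<subseteq> rem \<omega>} \<le> (1 / real Delta ^ 98) ^ s"
        using w by (simp add: W'_def)
    qed
    also have "\<dots> = real (card W') * (1 / real Delta ^ 98) ^ s" by simp
    \<comment> \<open>A walk has \<open>2 * (s - 1)\<close> steps, each with at most
      \<open>(Delta + 1) ^ 5 \<le> Delta ^ 10\<close> choices, hence the exponent
      \<open>20 * s\<close>. Against 98 this leaves 78 per separated node.\<close>
    also have "\<dots> \<le> (real n * real Delta ^ (20 * s)) * (1 / real Delta ^ 98) ^ s"
    proof (rule mult_right_mono)
      have "real (card W') \<le> real (n * ((Delta + 1) ^ 5) ^ l)" using W W' by (simp only: of_nat_le_iff)
      also have "\<dots> = real n * real (Delta + 1) ^ (5 * l)" by (simp add: power_mult)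
      also have "real (Delta + 1) ^ (5 * l) \<le> (real Delta ^ 2) ^ (5 * l)"
      proof (rule power_mono)
        have "3 * real Delta \<le> real Delta * real Delta" using G(2) by (intro mult_right_mono) auto
        then show "real (Delta + 1) \<le> real Delta ^ 2" using G(2) unfolding power2_eq_square by linarith
      qed simp
      also have "\<dots> = real Delta ^ (10 * l)" by (simp flip: power_mult)
      also have "\<dots> \<le> real Delta ^ (20 * s)" using G(2) by (intro power_increasing) (auto simp: l_def)
      finally show "real (card W') \<le> real n * real Delta ^ (20 * s)" by (simp add: mult_left_mono)
    qed simp
    also have "\<dots> \<le> real n / real n powr (a + 1)"
    proof -
      have "real n powr (a + 1) = real Delta powr ((a + 1) * L)"
      proof -
        have "real n = real Delta powr L" using n G(2) by (simp add: L_def)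
        then show ?thesis by (metis mult.commute powr_powr)
      qed
      also have "\<dots> \<le> real Delta powr s" using s(2) G(2) by (intro powr_mono) auto
      also have "\<dots> = real Delta ^ s" using G(2) by (simp add: powr_realpow)
      also have "\<dots> \<le> real Delta ^ (78 * s)" using G(2) by (intro power_increasing) auto
      finally have "real n powr (a + 1) \<le> real Delta ^ (78 * s)" .
      then have "real n / real Delta ^ (78 * s) \<le> real n / real n powr (a + 1)"
        using n G(2) by (intro divide_left_mono) auto
      moreover have "real Delta ^ (20 * s) * (1 / real Delta ^ 98) ^ s = 1 / real Delta ^ (78 * s)"
      proof -
        have "real Delta ^ (98 * s) = real Delta ^ (20 * s) * real Delta ^ (78 * s)" by (simp flip: power_add)
        moreover have "(1 / real Delta ^ 98) ^ s = 1 / real Delta ^ (98 * s)" by (simp add: power_divide power_mult)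
        ultimately show ?thesis using G(2) by simp
      qed
      ultimately show ?thesis by (simp add: mult.assoc)
    qed
    also have "\<dots> = 1 / real n powr a" using n by (simp add: powr_add)
    finally show ?thesis .
  qed
  then show ?thesis
    using prob_compl[OF A] by (simp add: small_def rem_def bnd_def n_def)
qed

end

text \<open>\<open>c0\<close> and \<open>C0\<close> are chosen before \<open>a\<close>: a smaller
  failure probability is obtained by looking for more separated nodes, which affects only the size
  bound \<open>K\<close>.\<close>

theorem theorem4p1:
  shows "\<exists>c0 > 0. \<exists>C0 > 0.
    (\<forall>c \<ge> c0. \<forall>C \<ge> C0. \<forall>G :: ('a, 'b) pre_digraph. graph G \<and> max_degree G \<ge> 3 \<longrightarrow>
      (\<forall>v \<in> verts G.
        (let \<Delta> = max_degree G;
             M = randomness (verts G) C c \<Delta>;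
             N = two_hop G v;
             M_in = randomness N C c \<Delta>;
             M_out = randomness (verts G - N) C c \<Delta>;
             glue = merge (node_coins N C c \<Delta>) (node_coins (verts G - N) C c \<Delta>)
         in measure M {\<omega> \<in> space M. covered G C c v \<omega>} \<ge> 1 - 1 / real \<Delta> ^ 98 \<and>
            (\<forall>\<eta> \<in> space M_out.
               measure M_in {\<omega> \<in> space M_in. covered G C c v (glue (\<omega>, \<eta>))}
                 \<ge> 1 - 1 / real \<Delta> ^ 98)))) \<and>
    (\<forall>a > 0. \<exists>K > 0.
      \<forall>c \<ge> c0. \<forall>C \<ge> C0. \<forall>G :: ('a, 'b) pre_digraph. graph G \<and> max_degree G \<ge> 3 \<longrightarrow>
        (let \<Delta> = max_degree G;
             n = card (verts G);
             M = randomness (verts G) C c \<Delta>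
         in measure M {\<omega> \<in> space M.
              (let B = remaining (final_state G C c \<omega>)
               in \<forall>H. graph_component (G \<restriction> B) H \<longrightarrow>
                    real (card (verts H)) \<le> K * (log (real \<Delta>) (real n) * real \<Delta> ^ 4))}
            \<ge> 1 - 1 / real n powr a))"
proof -
  obtain \<beta> c0 C0 :: real where \<beta>: "1 < \<beta>" "\<beta> powr 8 * (1 - exp (- 60) / 2560) \<le> 1"
    and pos: "0 < c0" "0 < C0"
    and par: "\<And>c C \<Delta>. c0 \<le> c \<Longrightarrow> C0 \<le> C \<Longrightarrow> 3 \<le> \<Delta> \<Longrightarrow> 0 < num_reps C \<Delta> \<and>
      (1 / \<beta> + real (\<Delta> + 1) * (1 / 4) ^ num_reps C \<Delta> * \<beta> powr (7 + log 2 \<Delta>)) ^ num_iters c \<Delta>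
        * \<beta> powr (30 + 6 * log 2 \<Delta>) \<le> 1 / real \<Delta> ^ 98"
    using parameters by blast
  show ?thesis
  proof (((rule exI[of _ c0], rule conjI[OF pos(1)], rule exI[of _ C0], rule conjI[OF pos(2)], rule conjI);
      intro allI impI ballI), goal_cases)
    case (1 c C G v)
    then have G: "graph G" "3 \<le> max_degree G" by auto
    note par = par[OF 1(1,2) G(2)]
    interpret mis_graph G "max_degree G" "num_iters c (max_degree G)" "num_reps C (max_degree G)"
      by (rule mis_graph_max_degree[OF G par[THEN conjunct1]])
    have local: "two_hop G v \<subseteq> verts G" using 1(4) by (rule two_hop_subset)
    \<comment> \<open>Used twice below: with all coins random and the identity as
      \<open>glue\<close>, and with only the two-hop coins random and the others fixed to
      \<open>\<eta>\<close>.\<close>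
    note covered = covered_prob[OF G par[THEN conjunct1] _ _ \<beta> par[THEN conjunct2] 1(4)]
    show ?case
      unfolding Let_def
    proof (intro conjI ballI)
      show "1 - 1 / real (max_degree G) ^ 98 \<le> measure (randomness (verts G) C c (max_degree G))
          {\<omega> \<in> space (randomness (verts G) C c (max_degree G)). covered G C c v \<omega>}"
        using local by (intro covered[where glue = "\<lambda>\<omega>. \<omega>" and \<eta> = "\<lambda>_. 0"]) auto
      fix \<eta> :: "'a \<times> coin \<Rightarrow> real"
      let ?glue = "\<lambda>\<omega> :: 'a \<times> coin \<Rightarrow> real. merge (node_coins (two_hop G v) C c (max_degree G))
        (node_coins (verts G - two_hop G v) C c (max_degree G)) (\<omega>, \<eta>)"
      show "1 - 1 / real (max_degree G) ^ 98 \<le> measure (randomness (two_hop G v) C c (max_degree G))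
          {\<omega> \<in> space (randomness (two_hop G v) C c (max_degree G)). covered G C c v (?glue \<omega>)}"
        using local by (intro covered[where glue = ?glue and \<eta> = \<eta>]) (auto simp: merge_def node_coins_def)
    qed
  next
    case (2 a)
    show ?case
    proof (intro exI[of _ "4 * (a + 1)"] conjI allI impI)
      show "0 < 4 * (a + 1)" using 2 by simp
      fix c C :: real and G :: "('a, 'b) pre_digraph"
      assume c: "c0 \<le> c" and C: "C0 \<le> C" and G: "graph G \<and> 3 \<le> max_degree G"
      then have par: "0 < num_reps C (max_degree G)"
        "(1 / \<beta> + real (max_degree G + 1) * (1 / 4) ^ num_reps C (max_degree G)
            * \<beta> powr (7 + log 2 (max_degree G))) ^ num_iters c (max_degree G)
          * \<beta> powr (30 + 6 * log 2 (max_degree G)) \<le> 1 / real (max_degree G) ^ 98"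
        using par[OF c C] by auto
      show "let \<Delta> = max_degree G;
             n = card (verts G);
             M = randomness (verts G) C c \<Delta>
         in measure M {\<omega> \<in> space M.
              (let B = remaining (final_state G C c \<omega>)
               in \<forall>H. graph_component (G \<restriction> B) H \<longrightarrow>
                    real (card (verts H)) \<le> 4 * (a + 1) * (log (real \<Delta>) (real n) * real \<Delta> ^ 4))}
            \<ge> 1 - 1 / real n powr a"
        using small_components_prob[OF _ _ par(1) \<beta> par(2) 2] G unfolding Let_def by blast
    qed
  qed
qed

end
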